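(* Let $n$ be a positive odd integer, and for $k\geqslant 0$ let $$c_q(k)=(-1)^kq^{k^2}[4k+1]\frac{(q;q^2)_k^3}{(q^2;q^2)_k^3}.$$ Then $$\sum_{k=0}^{n-1}\sum_{j=0}^{k}c_q(j)c_q(k-j)\equiv q^{(n-1)^2/2}[n]^2\pmod{[n]\Phi_n(q)^3}.$$
   Context: Here $q$ is an indeterminate. The $q$-shifted factorial is $(x;q)_0=1$ and $(x;q)_m=(1-x)(1-xq)\cdots(1-xq^{m-1})$ for $m\geqslant1$; the $q$-integer is $[m]=1+q+\cdots+q^{m-1}=(1-q^m)/(1-q)$. $\Phi_n(q)$ denotes the $n$-th cyclotomic polynomial. For rational functions $A,B$ in $q$ and a polynomial $P$, $A\equiv B\pmod{P}$ means that $A-B=P\cdot U/V$ for polynomials $U,V$ with $V$ coprime to $P$. *)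

theory Defs
  imports Complex_Main "HOL-Computational_Algebra.Computational_Algebra"
begin

section \<open>Cyclotomic polynomials\<close>

definition prim_roots_unity :: "nat \<Rightarrow> complex set" where
  "prim_roots_unity n = {z. z ^ n = 1 \<and> (\<forall>m. 0 < m \<and> m < n \<longrightarrow> z ^ m \<noteq> 1)}"

text \<open>
  The \<open>n\<close>-th cyclotomic polynomial, for \<open>n > 0\<close>, is the rational polynomial whose image over the
  complex numbers is the product of \<open>X - z\<close> over the primitive \<open>n\<close>-th roots of unity \<open>z\<close>.
  The lemma \<open>of_rat_cyclotomic\<close> below shows that this polynomial exists.
\<close>

definition cyclotomic :: "nat \<Rightarrow> rat poly" where
  "cyclotomic n = (THE p. map_poly of_rat p = (\<Prod>z\<in>prim_roots_unity n. [:-z, 1:]))"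

lemma finite_prim_roots_unity: "n > 0 \<Longrightarrow> finite (prim_roots_unity n)"
  unfolding prim_roots_unity_def
  by (rule finite_subset[OF _ finite_roots_unity[of n]]) auto

lemma roots_unity_eq_UN:
  assumes "n > 0"
  shows "{z :: complex. z ^ n = 1} = (\<Union>d\<in>{d. d dvd n}. prim_roots_unity d)"
proof (intro equalityI subsetI)
  fix z :: complex assume "z \<in> {z. z ^ n = 1}"
  hence z: "z ^ n = 1" by simp
  define d where "d = (LEAST m. 0 < m \<and> z ^ m = 1)"
  have d: "0 < d \<and> z ^ d = 1"
    unfolding d_def by (rule LeastI[of _ n]) (use assms z in auto)
  have least: "z ^ m \<noteq> 1" if "0 < m" "m < d" for m
    using not_less_Least[of m "\<lambda>m. 0 < m \<and> z ^ m = 1"] that by (auto simp: d_def)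
  have "z ^ n = (z ^ d) ^ (n div d) * z ^ (n mod d)"
    by (simp flip: power_mult power_add)
  hence "z ^ (n mod d) = 1" by (metis d z power_one mult_1)
  hence "d dvd n" using least[of "n mod d"] d by (auto simp: dvd_eq_mod_eq_0)
  thus "z \<in> (\<Union>d\<in>{d. d dvd n}. prim_roots_unity d)"
    using d least by (auto simp: prim_roots_unity_def)
next
  fix z :: complex assume "z \<in> (\<Union>d\<in>{d. d dvd n}. prim_roots_unity d)"
  thus "z \<in> {z. z ^ n = 1}"
    by (auto simp: prim_roots_unity_def power_mult elim!: dvdE)
qed

lemma prim_roots_unity_disjoint:
  assumes "c \<noteq> d" "c > 0" "d > 0"
  shows "prim_roots_unity c \<inter> prim_roots_unity d = {}"
  using assms unfolding prim_roots_unity_def by (cases c d rule: linorder_cases) auto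

lemma prod_prim_roots_unity:
  assumes "n > 0"
  shows "(\<Prod>d | d dvd n. \<Prod>z\<in>prim_roots_unity d. [:-z, 1:]) = monom 1 n - (1 :: complex poly)"
proof -
  let ?p = "monom 1 n - (1 :: complex poly)"
  have deg: "degree ?p = n" and lc: "coeff ?p n = 1"
  proof -
    have "degree (monom (1::complex) n + (-1)) = degree (monom (1::complex) n)"
      by (rule degree_add_eq_left) (use assms in \<open>simp add: degree_monom_eq\<close>)
    thus "degree ?p = n" by (simp add: degree_monom_eq)
    show "coeff ?p n = 1" using assms by simp
  qed
  have roots: "{z. poly ?p z = 0} = {z. z ^ n = 1}"
    by (auto simp: poly_monom)
  have "rsquarefree ?p"
  proof (subst rsquarefree_roots, intro allI notI, elim conjE)
    fix z assume "poly ?p z = 0" "poly (pderiv ?p) z = 0"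
    thus False using assms by (auto simp: pderiv_diff pderiv_monom poly_monom power_0_left)
  qed
  from complex_poly_decompose_rsquarefree[OF this]
  have "?p = (\<Prod>z\<in>{z. z ^ n = 1}. [:-z, 1:])"
    by (simp only: deg lc roots smult_1_left)
  also have "\<dots> = (\<Prod>d | d dvd n. \<Prod>z\<in>prim_roots_unity d. [:-z, 1:])"
    unfolding roots_unity_eq_UN[OF assms]
  proof (rule prod.UNION_disjoint)
    show "finite {d. d dvd n}" using assms by simp
    show "\<forall>d\<in>{d. d dvd n}. finite (prim_roots_unity d)"
      using finite_prim_roots_unity dvd_pos_nat[OF assms] by blast
    show "\<forall>c\<in>{d. d dvd n}. \<forall>d\<in>{d. d dvd n}. c \<noteq> d \<longrightarrow> prim_roots_unity c \<inter> prim_roots_unity d = {}"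
      using prim_roots_unity_disjoint dvd_pos_nat[OF assms] by blast
  qed
  finally show ?thesis ..
qed

lemma map_poly_of_rat_add:
  "map_poly (of_rat :: rat \<Rightarrow> complex) (p + q) = map_poly of_rat p + map_poly of_rat q"
  by (intro poly_eqI) (simp add: coeff_map_poly of_rat_add)

lemma map_poly_of_rat_mult:
  "map_poly (of_rat :: rat \<Rightarrow> complex) (p * q) = map_poly of_rat p * map_poly of_rat q"
  by (intro poly_eqI) (simp add: coeff_map_poly coeff_mult of_rat_sum of_rat_mult)

lemma map_poly_of_rat_prod:
  "map_poly (of_rat :: rat \<Rightarrow> complex) (\<Prod>x\<in>A. f x) = (\<Prod>x\<in>A. map_poly of_rat (f x))"
  by (induction A rule: infinite_finite_induct) (simp_all add: map_poly_of_rat_mult)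

lemma map_poly_of_rat_inj:
  "map_poly (of_rat :: rat \<Rightarrow> complex) p = map_poly of_rat q \<longleftrightarrow> p = q"
  by (auto simp: poly_eq_iff coeff_map_poly)

lemma ex_of_rat_cyclotomic:
  assumes "n > 0"
  shows "\<exists>p :: rat poly. map_poly of_rat p = (\<Prod>z\<in>prim_roots_unity n. [:-z, 1:])"
  using assms
proof (induction n rule: less_induct)
  case (less n)
  let ?C = "\<lambda>d. \<Prod>z\<in>prim_roots_unity d. [:-z, 1:]"
  let ?D = "{d. d dvd n} - {n}"
  have "\<forall>d\<in>?D. \<exists>p :: rat poly. map_poly of_rat p = ?C d"
  proof
    fix d assume "d \<in> ?D"
    hence "d < n" "d > 0"
      using dvd_imp_le[of d n] dvd_pos_nat[of n d] less.prems by auto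
    thus "\<exists>p :: rat poly. map_poly of_rat p = ?C d" by (rule less.IH)
  qed
  then obtain f :: "nat \<Rightarrow> rat poly" where f: "\<And>d. d \<in> ?D \<Longrightarrow> map_poly of_rat (f d) = ?C d"
    by metis
  define P where "P = (\<Prod>d\<in>?D. f d)"
  define X where "X = (monom 1 n - 1 :: rat poly)"
  have P: "map_poly of_rat P = (\<Prod>d\<in>?D. ?C d)"
    by (simp add: P_def map_poly_of_rat_prod f)
  have X: "map_poly of_rat X = (monom 1 n - 1 :: complex poly)"
    by (intro poly_eqI) (auto simp: X_def coeff_map_poly of_rat_diff)
  have "map_poly of_rat X = (\<Prod>d | d dvd n. ?C d)"
    using prod_prim_roots_unity[of n] less.prems X by simp
  also have "\<dots> = ?C n * map_poly of_rat P"
    unfolding P by (rule prod.remove) (use less.prems in auto)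
  finally have 1: "map_poly of_rat X = ?C n * map_poly of_rat P" .
  have "map_poly of_rat P \<noteq> (0 :: complex poly)"
  proof
    assume "map_poly of_rat P = (0 :: complex poly)"
    with 1 X have "monom 1 n = (1 :: complex poly)" by simp
    from arg_cong[OF this, of degree] show False
      using less.prems by (simp add: degree_monom_eq)
  qed
  hence P0: "P \<noteq> 0" by auto
  have deg: "degree (map_poly (of_rat :: rat \<Rightarrow> complex) p) = degree p" for p
    by (rule degree_map_poly) auto
  have "X = X div P * P + X mod P" by simp
  hence "map_poly of_rat X = map_poly of_rat (X div P) * map_poly of_rat P +
           (map_poly of_rat (X mod P) :: complex poly)"
    by (metis map_poly_of_rat_add map_poly_of_rat_mult)
  hence 2: "map_poly of_rat (X mod P) = (?C n - map_poly of_rat (X div P)) * map_poly of_rat P"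
    using 1 by (simp add: algebra_simps)
  have "?C n - map_poly of_rat (X div P) = 0"
  proof (rule ccontr)
    assume nz: "?C n - map_poly of_rat (X div P) \<noteq> 0"
    hence nz': "map_poly of_rat (X mod P) \<noteq> (0 :: complex poly)"
      using 2 \<open>map_poly of_rat P \<noteq> 0\<close> by simp
    hence "X mod P \<noteq> 0" by auto
    hence "degree (X mod P) < degree P" using degree_mod_less[OF P0, of X] by simp
    moreover have "degree P \<le> degree (X mod P)"
      using arg_cong[OF 2, of degree] nz \<open>map_poly of_rat P \<noteq> 0\<close>
      by (simp add: deg degree_mult_eq)
    ultimately show False by simp
  qed
  thus ?case by (intro exI[of _ "X div P"]) simp
qed

lemma of_rat_cyclotomic:
  assumes "n > 0"
  shows "map_poly of_rat (cyclotomic n) = (\<Prod>z\<in>prim_roots_unity n. [:-z, 1:])"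
proof -
  obtain p :: "rat poly" where p: "map_poly of_rat p = (\<Prod>z\<in>prim_roots_unity n. [:-z, 1:])"
    using ex_of_rat_cyclotomic[OF assms] by blast
  show ?thesis unfolding cyclotomic_def
    by (rule theI[of _ p]) (use p in \<open>simp_all flip: map_poly_of_rat_inj\<close>)
qed


section \<open>Rational functions in an indeterminate and \<open>q\<close>-notation\<close>

type_synonym ratfun = "rat poly fract"

definition ratfun_q :: ratfun where
  "ratfun_q = to_fract [:0, 1:]"

definition qpoch :: "'a :: comm_ring_1 \<Rightarrow> 'a \<Rightarrow> nat \<Rightarrow> 'a" where
  "qpoch x q m = (\<Prod>i<m. 1 - x * q ^ i)"

definition qint :: "'a :: comm_ring_1 \<Rightarrow> nat \<Rightarrow> 'a" where
  "qint q m = (\<Sum>i<m. q ^ i)"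

definition ratfun_cong :: "ratfun \<Rightarrow> ratfun \<Rightarrow> rat poly \<Rightarrow> bool" where
  "ratfun_cong A B P \<longleftrightarrow>
     (\<exists>U V. V \<noteq> 0 \<and> coprime V P \<and> A - B = to_fract P * (to_fract U / to_fract V))"

definition cq :: "nat \<Rightarrow> ratfun" where
  "cq k = (let q = ratfun_q in
     (-1) ^ k * q ^ (k\<^sup>2) * qint q (4 * k + 1) * (qpoch q (q\<^sup>2) k ^ 3 / qpoch (q\<^sup>2) (q\<^sup>2) k ^ 3))"

end

theory Submission
  imports Defs "HOL-Computational_Algebra.Field_as_Ring"
begin

text \<open>
  Write \<open>c\<^sub>k\<close> for \<open>cq k\<close>, \<open>n = 2 m + 1\<close>, and \<open>D\<close> for the double sum. Everything happens in the local rings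
  \<open>{U / V. coprime V \<Phi>\<^sub>d}\<close>, in which all \<open>c\<^sub>k\<close> lie.

  Modulo \<open>\<Phi>\<^sub>n\<close> the terms satisfy \<open>c\<^bsub>m - k\<^esub> \<equiv> - c\<^sub>k\<close>, and \<open>c\<^sub>k\<close> vanishes to third order for
  \<open>m < k < n\<close>. Deforming two of the three factors \<open>(q; q\<^sup>2)\<^sub>k / (q\<^sup>2; q\<^sup>2)\<^sub>k\<close> by a parameter \<open>y\<close> gives, at
  \<open>y = q\<^sup>n\<close>, a sum that is evaluated exactly by a WZ pair. The deformation depends on
  \<open>t = (1 - y)\<^sup>2 / y \<equiv> 0 (mod \<Phi>\<^sub>n\<^sup>2)\<close> only, and its linear term vanishes modulo \<open>\<Phi>\<^sub>n\<close> by antisymmetry,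
  whence \<open>A = c\<^sub>0 + \<dots> + c\<^sub>m \<equiv> (-1)\<^sup>m q\<^bsup>m * m\<^esup> [n] (mod \<Phi>\<^sub>n\<^sup>3)\<close>. Since both sides vanish modulo \<open>\<Phi>\<^sub>n\<close>, squaring
  gains one more power. The rest of the double sum, \<open>D - A\<^sup>2\<close>, consists of products \<open>c\<^sub>i c\<^sub>j\<close> with exactly one index
  above \<open>m\<close>, and the coefficient of \<open>\<Phi>\<^sub>n\<^sup>3\<close> in it again cancels by an antisymmetry.

  For a proper divisor \<open>d\<close> of \<open>n\<close> one has \<open>c\<^bsub>a d + b\<^esub> \<equiv> C\<^sub>a c\<^sub>b (mod \<Phi>\<^sub>d)\<close>, where \<open>c\<^sub>b\<close> vanishes in the upper half
  of each block and sums to zero over the block. Hence \<open>D \<equiv> 0 (mod \<Phi>\<^sub>d)\<close>.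
\<close>

section \<open>An exact evaluation by a WZ pair\<close>

text \<open>Deforms two of the three factors of \<open>cq\<close>, by \<open>y\<close> and by
  \<open>1 / y\<close>: here \<open>y - q^j\<close> stands for \<open>1 - q^j / y\<close>, as the
  powers of \<open>y\<close> cancel in the quotient. At \<open>y = 1\<close>, with \<open>q\<close>
  the indeterminate, the term is \<open>cq k\<close>.\<close>

definition wz_term :: "'a::field \<Rightarrow> 'a \<Rightarrow> nat \<Rightarrow> 'a" where
  "wz_term q y k = (-1) ^ k * q ^ (k\<^sup>2) * ((1 - q ^ (4 * k + 1)) / (1 - q)) *
     (\<Prod>i<k. (1 - q ^ (2 * i + 1)) * (1 - q ^ (2 * i + 1) * y) * (y - q ^ (2 * i + 1)) /
            ((1 - q ^ (2 * i + 2)) * (1 - q ^ (2 * i + 2) * y) * (y - q ^ (2 * i + 2))))"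

lemma wz_term_0: "q \<noteq> 1 \<Longrightarrow> wz_term q y 0 = 1"
  by (simp add: wz_term_def)

text \<open>The quotient of consecutive terms. Dividing by \<open>1 - q^(4 k + 1)\<close> removes
  the q-integer of the old term, which is why this factor has to be nonzero.\<close>

lemma wz_term_Suc:
  fixes q y :: "'a::field"
  assumes "1 - q ^ (4 * k + 1) \<noteq> 0"
  defines "x \<equiv> q ^ (2 * k)"
  shows "wz_term q y (Suc k) = wz_term q y k *
    (- (q * x) * (1 - q ^ 5 * x\<^sup>2) * ((1 - q * x) * (1 - q * x * y) * (y - q * x)) /
     ((1 - q * x\<^sup>2) * ((1 - q\<^sup>2 * x) * (1 - q\<^sup>2 * x * y) * (y - q\<^sup>2 * x))))"
proof -
  have e: "q ^ (4 * k + 1) = q * x\<^sup>2" "q ^ (4 * Suc k + 1) = q ^ 5 * x\<^sup>2"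
    "q ^ (2 * k + 1) = q * x" "q ^ (2 * k + 2) = q\<^sup>2 * x" "q ^ (Suc k)\<^sup>2 = q ^ k\<^sup>2 * (q * x)"
    by (simp_all add: x_def power2_eq_square power_mult_distrib algebra_simps
        flip: power_add power_mult power_Suc)
       (simp_all add: eval_nat_numeral algebra_simps flip: power_add)
  define w where "w = (\<Prod>i<k. (1 - q ^ (2 * i + 1)) * (1 - q ^ (2 * i + 1) * y) * (y - q ^ (2 * i + 1)) /
            ((1 - q ^ (2 * i + 2)) * (1 - q ^ (2 * i + 2) * y) * (y - q ^ (2 * i + 2))))"
  define a b c where "a = 1 - q * x\<^sup>2" and "b = (1 - q * x) * (1 - q * x * y) * (y - q * x)"
    and "c = (1 - q\<^sup>2 * x) * (1 - q\<^sup>2 * x * y) * (y - q\<^sup>2 * x)"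
  have "a \<noteq> 0" using assms(1) unfolding e a_def .
  have "(-1) ^ Suc k * (q ^ k\<^sup>2 * (q * x)) * ((1 - q ^ 5 * x\<^sup>2) / (1 - q)) * (w * (b / c)) =
     (-1) ^ k * q ^ k\<^sup>2 * (a / (1 - q)) * w * (- (q * x) * (1 - q ^ 5 * x\<^sup>2) * b / (a * c))"
    using \<open>a \<noteq> 0\<close> by (simp add: mult_ac)
  thus ?thesis
    unfolding wz_term_def prod.lessThan_Suc e w_def[symmetric] a_def b_def c_def .
qed

text \<open>
  The index is shifted on the left only: at \<open>y = q\<^bsup>2 k + 1\<^esup>\<close> the quotient
  \<open>wz_term q (q\<^sup>2 y) (k + 1) / wz_term q y (k + 1)\<close> has a pole.
\<close>

lemma wz_term_shift:
  fixes q y :: "'a::field"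
  assumes q: "q \<noteq> 0" and qj: "\<And>j. j > 0 \<Longrightarrow> 1 - q ^ j \<noteq> 0"
    and y: "\<And>j. 1 - q ^ j * y \<noteq> 0" "\<And>j. y - q ^ (2 * j) \<noteq> 0"
  defines "x \<equiv> \<lambda>k. q ^ (2 * k)"
  shows "wz_term q (q\<^sup>2 * y) (Suc k) = wz_term q y k *
    (- x k * (1 - q ^ 5 * (x k)\<^sup>2) * (1 - q * x k) * (1 - q * x k * y) *
      (1 - q ^ 3 * x k * y) * (1 - q\<^sup>2 * y) /
     ((1 - q * (x k)\<^sup>2) * (1 - q\<^sup>2 * x k) * (1 - q\<^sup>2 * x k * y) * (1 - q ^ 4 * x k * y) * (1 - y)))"
proof (induction k)
  case 0
  define b where "b = 1 - q ^ 5"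
  have "1 - q \<noteq> 0" "1 - q\<^sup>2 \<noteq> 0" using qj[of 1] qj[of 2] by auto
  moreover have "1 - q * y \<noteq> 0" "1 - q\<^sup>2 * y \<noteq> 0" "1 - q^4 * y \<noteq> 0" "1 - y \<noteq> 0"
    using y(1)[of 1] y(1)[of 2] y(1)[of 4] y(1)[of 0] by auto
  moreover have e: "q\<^sup>2 * y - q = - (q * (1 - q * y))" "q\<^sup>2 * y - q\<^sup>2 = - (q * (q * (1 - y)))"
    "q * (q\<^sup>2 * y) = q ^ 3 * y" "q\<^sup>2 * (q\<^sup>2 * y) = q ^ 4 * y"
    by (simp_all add: algebra_simps power2_eq_square power3_eq_cube power4_eq_xxxx)
  moreover have "wz_term q (q\<^sup>2 * y) (Suc 0) = - q * (b / (1 - q)) *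
     ((1 - q) * (1 - q * (q\<^sup>2 * y)) * (q\<^sup>2 * y - q) /
      ((1 - q\<^sup>2) * (1 - q\<^sup>2 * (q\<^sup>2 * y)) * (q\<^sup>2 * y - q\<^sup>2)))"
    by (simp add: wz_term_def power2_eq_square b_def)
  moreover have "wz_term q y 0 = 1"
    using \<open>1 - q \<noteq> 0\<close> by (simp add: wz_term_def)
  moreover have "1 - q ^ 5 * (x 0)\<^sup>2 = b" "x 0 = 1" by (simp_all add: b_def x_def)
  ultimately show ?case using q unfolding e
    by (simp add: mult_ac)
next
  case (Suc k)
  have nz: "1 - q * (x k)\<^sup>2 \<noteq> 0" "1 - q ^ 5 * (x k)\<^sup>2 \<noteq> 0" "1 - q\<^sup>2 * x k \<noteq> 0" "1 - q^4 * x k \<noteq> 0"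
    using qj[of "4*k+1"] qj[of "4*k+5"] qj[of "2*k+2"] qj[of "2*k+4"]
    by (simp_all add: x_def flip: power_add power_mult) (simp_all add: algebra_simps power_add)
  have nzy: "1 - q\<^sup>2 * x k * y \<noteq> 0" "1 - q^4 * x k * y \<noteq> 0" "1 - q^6 * x k * y \<noteq> 0"
    "1 - q * x k * y \<noteq> 0" "1 - q^3 * x k * y \<noteq> 0" "1 - y \<noteq> 0"
    using y(1)[of "2*k+2"] y(1)[of "2*k+4"] y(1)[of "2*k+6"] y(1)[of "2*k+1"] y(1)[of "2*k+3"] y(1)[of 0]
    by (simp_all add: x_def flip: power_add power_mult) (simp_all add: algebra_simps power_add)
  have nz3: "y - q\<^sup>2 * x k \<noteq> 0" using y(2)[of "k+1"]
    by (simp add: x_def power_add algebra_simps power2_eq_square)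
  have xS: "x (Suc k) = q\<^sup>2 * x k" by (simp add: x_def power2_eq_square)
  have p: "1 - q ^ (4 * Suc k + 1) \<noteq> 0" "1 - q ^ (4 * k + 1) \<noteq> 0" by (rule qj, simp)+
  define X where "X = x k"
  define a b c d f where "a = 1 - q * X\<^sup>2" and "b = 1 - q ^ 5 * X\<^sup>2"
    and "c = 1 - q\<^sup>2 * X" and "d = y - q\<^sup>2 * X" and "f = y - q * X"
  define a' b' where "a' = 1 - q ^ 4 * X * y" and "b' = 1 - q\<^sup>2 * X * y"
  have nz': "a \<noteq> 0" "b \<noteq> 0" "c \<noteq> 0" "d \<noteq> 0" "a' \<noteq> 0" "b' \<noteq> 0"
    using nz nzy nz3 unfolding a_def b_def c_def d_def a'_def b'_def X_def by simp_all
  \<comment> \<open>Replacing \<open>y\<close> by \<open>q\<^sup>2 * y\<close> moves each factor to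
    a neighbouring one: the factors \<open>f\<close> and \<open>d\<close> of the unshifted quotient
    reappear up to \<open>q\<^sup>2\<close>, so that they cancel.\<close>
  have e: "q * (q\<^sup>2 * X)\<^sup>2 = q ^ 5 * X\<^sup>2" "q * (q\<^sup>2 * X) = q ^ 3 * X"
    "q ^ 5 * (q\<^sup>2 * X)\<^sup>2 = q ^ 9 * X\<^sup>2" "q\<^sup>2 * (q\<^sup>2 * X) = q ^ 4 * X"
    "q ^ 3 * X * (q\<^sup>2 * y) = q ^ 5 * X * y" "q ^ 4 * X * (q\<^sup>2 * y) = q ^ 6 * X * y"
    "q ^ 4 * (q\<^sup>2 * X) * y = q ^ 6 * X * y" "q ^ 3 * (q\<^sup>2 * X) * y = q ^ 5 * X * y"
    "q\<^sup>2 * y - q ^ 3 * X = q\<^sup>2 * f" "q\<^sup>2 * y - q ^ 4 * X = q\<^sup>2 * d"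
    by (simp_all add: d_def f_def algebra_simps eval_nat_numeral)
  have 1: "wz_term q (q\<^sup>2 * y) (Suc (Suc k)) = wz_term q (q\<^sup>2 * y) (Suc k) *
     (- (q ^ 3 * X) * (1 - q ^ 9 * X\<^sup>2) * ((1 - q ^ 3 * X) * (1 - q ^ 5 * X * y) * (q\<^sup>2 * f)) /
     (b * ((1 - q ^ 4 * X) * (1 - q ^ 6 * X * y) * (q\<^sup>2 * d))))"
    using wz_term_Suc[OF p(1), of "q\<^sup>2 * y"] unfolding xS[unfolded x_def, folded X_def[unfolded x_def]] e b_def .
  have 2: "wz_term q y (Suc k) = wz_term q y k * (- (q * X) * b * ((1 - q * X) * (1 - q * X * y) * f) /
     (a * (c * b' * d)))"
    using wz_term_Suc[OF p(2), of y] unfolding a_def b_def c_def d_def f_def b'_def X_def x_def .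
  have IH: "wz_term q (q\<^sup>2 * y) (Suc k) = wz_term q y k * (- X * b * (1 - q * X) * (1 - q * X * y) *
      (1 - q ^ 3 * X * y) * (1 - q\<^sup>2 * y) / (a * c * b' * a' * (1 - y)))"
    using Suc.IH unfolding a_def b_def c_def b'_def a'_def X_def .
  show ?case
    unfolding xS X_def[symmetric] e 1 2 IH
    unfolding b_def[symmetric] c_def[symmetric] a'_def[symmetric]
    using nz' nzy(3,5,6) q unfolding X_def[symmetric]
    by (simp add: mult_ac eval_nat_numeral)
qed

text \<open>
  The factor \<open>y (1 - q\<^sup>2 y) / (1 - y)\<close> is minus the quotient of consecutive values of the right-hand
  side of \<open>wz_sum\<close>; the right-hand side here is the WZ certificate found by Gosper's algorithm.
\<close>

lemma wz_partial_sum: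
  fixes q y :: "'a::field"
  assumes q: "q \<noteq> 0" and qj: "\<And>j. j > 0 \<Longrightarrow> 1 - q ^ j \<noteq> 0"
    and y: "\<And>j. 1 - q ^ j * y \<noteq> 0" "\<And>j. y - q ^ (2 * j) \<noteq> 0"
  defines "x \<equiv> \<lambda>k. q ^ (2 * k)"
  shows "(\<Sum>k\<le>K. wz_term q (q\<^sup>2 * y) k + y * (1 - q\<^sup>2 * y) / (1 - y) * wz_term q y k) =
    wz_term q y K * (x K * (1 - q * x K * y) * (1 - q * x K) * (1 - q\<^sup>2 * y) * (1 + q * y) /
      ((1 - y) * (1 - q * (x K)\<^sup>2) * (1 - q\<^sup>2 * x K * y)))"
proof (induction K)
  case 0
  have q1: "1 - q \<noteq> 0" using qj[of 1] by auto
  have y0: "1 - y \<noteq> 0" "1 - q\<^sup>2 * y \<noteq> 0" using y(1)[of 0] y(1)[of 2] by auto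
  have "1 + y * (1 - q\<^sup>2 * y) / (1 - y) = (1 - q * y) * (1 + q * y) / (1 - y)"
    using y0(1) by (simp add: divide_simps) algebra
  thus ?case using q1 y0 by (simp add: x_def wz_term_0)
next
  case (Suc K)
  have nz: "1 - q * (x K)\<^sup>2 \<noteq> 0" "1 - q ^ 5 * (x K)\<^sup>2 \<noteq> 0" "1 - q\<^sup>2 * x K \<noteq> 0"
    using qj[of "4*K+1"] qj[of "4*K+5"] qj[of "2*K+2"]
    by (simp_all add: x_def flip: power_add power_mult) (simp_all add: algebra_simps power_add)
  have nzy: "1 - q\<^sup>2 * x K * y \<noteq> 0" "1 - q^4 * x K * y \<noteq> 0" "1 - y \<noteq> 0"
    using y(1)[of "2*K+2"] y(1)[of "2*K+4"] y(1)[of 0]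
    by (simp_all add: x_def flip: power_add power_mult) (simp_all add: algebra_simps power_add)
  have nz3: "y - q\<^sup>2 * x K \<noteq> 0" using y(2)[of "K+1"]
    by (simp add: x_def power_add algebra_simps power2_eq_square)
  have p: "1 - q ^ (4 * K + 1) \<noteq> 0" by (rule qj) simp
  have xS: "x (Suc K) = q\<^sup>2 * x K" by (simp add: x_def power2_eq_square)
  have e: "q * (x (Suc K))\<^sup>2 = q ^ 5 * (x K)\<^sup>2" "q * x (Suc K) = q ^ 3 * x K"
    "q\<^sup>2 * x (Suc K) = q ^ 4 * x K"
    by (simp_all add: xS algebra_simps eval_nat_numeral)
  define X l where "X = x K" and "l = 1 - y"
  define a b c d e f T where "a = 1 - q * X\<^sup>2" and "b = 1 - q ^ 5 * X\<^sup>2"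
    and "c = 1 - q\<^sup>2 * X" and "d = 1 - q\<^sup>2 * X * y" and "e = 1 - q ^ 4 * X * y"
    and "f = y - q\<^sup>2 * X" and "T = wz_term q y K"
  note defs = a_def b_def c_def d_def e_def f_def T_def X_def l_def
  have nz': "a \<noteq> 0" "b \<noteq> 0" "c \<noteq> 0" "d \<noteq> 0" "e \<noteq> 0" "f \<noteq> 0" "l \<noteq> 0"
    using nz nzy nz3 unfolding defs by simp_all
  define D where "D = a * c * d * e * f * l"
  define N where "N = X * (1 - q * X * y) * (1 - q * X) * (1 - q\<^sup>2 * y)"
  have 1: "T * (X * (1 - q * X * y) * (1 - q * X) * (1 - q\<^sup>2 * y) * (1 + q * y) / (l * a * d))
      = T * N / D * ((1 + q * y) * c * e * f)"
    using nz' by (simp add: D_def N_def mult_ac)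
  have 2: "wz_term q (q\<^sup>2 * y) (Suc K) = T * N / D * (- b * (1 - q ^ 3 * X * y) * f)"
  proof -
    have "wz_term q (q\<^sup>2 * y) (Suc K) = T * (- X * b * (1 - q * X) * (1 - q * X * y) *
      (1 - q ^ 3 * X * y) * (1 - q\<^sup>2 * y) / (a * c * d * e * l))"
      unfolding defs x_def by (rule wz_term_shift[OF q qj y])
    thus ?thesis using nz' by (simp add: D_def N_def mult_ac)
  qed
  have w: "wz_term q y (Suc K) = T * (- (q * X) * b * ((1 - q * X) * (1 - q * X * y) * (y - q * X)) /
     (a * (c * d * f)))"
    unfolding defs x_def by (rule wz_term_Suc[OF p])
  have 3: "y * (1 - q\<^sup>2 * y) / l * wz_term q y (Suc K) = T * N / D * (- q * y * b * (y - q * X) * e)"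
    unfolding w using nz' by (simp add: D_def N_def mult_ac)
  have 4: "wz_term q y (Suc K) * (q\<^sup>2 * X * (1 - q ^ 3 * X * y) * (1 - q ^ 3 * X) * (1 - q\<^sup>2 * y) * (1 + q * y) /
     (l * b * e)) = T * N / D * (- (q ^ 3 * X * (y - q * X) * (1 - q ^ 3 * X * y) * (1 - q ^ 3 * X) * (1 + q * y)))"
    unfolding w using nz' by (simp add: D_def N_def mult_ac power2_eq_square power3_eq_cube)
  \<comment> \<open>Over the common denominator \<open>D\<close>, with the common factor
    \<open>T * N\<close> taken out, the induction step is this polynomial identity.\<close>
  have 5: "(1 + q * y) * c * e * f + (- b * (1 - q ^ 3 * X * y) * f + - q * y * b * (y - q * X) * e)
     = - (q ^ 3 * X * (y - q * X) * (1 - q ^ 3 * X * y) * (1 - q ^ 3 * X) * (1 + q * y))"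
    unfolding a_def b_def c_def d_def e_def f_def X_def by algebra
  show ?case
    unfolding sum.atMost_Suc Suc.IH
    unfolding \<open>q * (x (Suc K))\<^sup>2 = _\<close> \<open>q * x (Suc K) = _\<close> \<open>q\<^sup>2 * x (Suc K) = _\<close>
    unfolding xS defs[symmetric] 1 2 3 4
    by (simp only: distrib_left[symmetric] 5)
qed

text \<open>Induction on \<open>m\<close>, each step of which multiplies \<open>y\<close> by
  \<open>q\<^sup>2\<close>. At \<open>y = q^(2 m + 1)\<close> the factor
  \<open>y - q^(2 m + 1)\<close> kills every term of index above \<open>m\<close>, so for
  \<open>K > m\<close> the right-hand side of \<open>wz_partial_sum\<close> is 0 and a recursion in
  \<open>m\<close> remains. With \<open>K\<close> fixed the same range serves both values of
  \<open>y\<close>.\<close>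

lemma wz_sum:
  fixes q :: "'a::field"
  assumes q: "q \<noteq> 0" and qj: "\<And>j. j > 0 \<Longrightarrow> 1 - q ^ j \<noteq> 0" and "m \<le> K"
  shows "(\<Sum>k\<le>K. wz_term q (q ^ (2 * m + 1)) k) = (-1) ^ m * q ^ m\<^sup>2 * ((1 - q ^ (2 * m + 1)) / (1 - q))"
  using \<open>m \<le> K\<close>
proof (induction m)
  case 0
  have "wz_term q q (Suc k) = 0" for k
    unfolding wz_term_def by (subst prod_zero) (auto intro!: bexI[of _ 0])
  hence "(\<Sum>k\<le>K. wz_term q q k) = wz_term q q 0"
    by (induction K) auto
  thus ?case using qj[of 1] by (simp add: wz_term_0)
next
  case (Suc m)
  define y where "y = q ^ (2 * m + 1)"
  have inj: "q ^ i \<noteq> q ^ j" if "i < j" for i j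
    using qj[of "j - i"] that q by (auto simp: power_diff)
  have y: "1 - q ^ j * y \<noteq> 0" for j using qj[of "j + (2*m+1)"] by (simp add: y_def power_add mult_ac)
  \<comment> \<open>An odd power of \<open>q\<close> never equals an even one, since
    \<open>q\<close> is not a root of unity.\<close>
  have y2: "y - q ^ (2 * j) \<noteq> 0" for j
    using inj[of "2*m+1" "2*j"] inj[of "2*j" "2*m+1"] unfolding y_def
    by (cases "2*m+1 < 2*j") (auto, presburger)
  have y1: "1 - y \<noteq> 0" using y[of 0] by simp
  have qy: "q ^ (2 * Suc m + 1) = q\<^sup>2 * y" by (simp add: y_def power2_eq_square)
  have "wz_term q y K = 0"
    unfolding wz_term_def y_def by (subst prod_zero) (use Suc.prems in \<open>auto intro!: bexI[of _ m]\<close>)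
  with wz_partial_sum[OF q qj y y2, of K]
  have "(\<Sum>k\<le>K. wz_term q (q\<^sup>2 * y) k) + y * (1 - q\<^sup>2 * y) / (1 - y) * (\<Sum>k\<le>K. wz_term q y k) = 0"
    by (simp add: sum.distrib sum_distrib_left)
  hence "(\<Sum>k\<le>K. wz_term q (q\<^sup>2 * y) k) = - (y * (1 - q\<^sup>2 * y) / (1 - y) * (\<Sum>k\<le>K. wz_term q y k))"
    by (simp only: eq_neg_iff_add_eq_0)
  also have "(\<Sum>k\<le>K. wz_term q y k) = (-1) ^ m * q ^ m\<^sup>2 * ((1 - y) / (1 - q))"
    using Suc.IH Suc.prems by (simp add: y_def)
  also have "- (y * (1 - q\<^sup>2 * y) / (1 - y) * \<dots>) = (-1) ^ Suc m * (q ^ m\<^sup>2 * y) * ((1 - q\<^sup>2 * y) / (1 - q))"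
    using y1 by (simp add: mult_ac)
  also have "q ^ m\<^sup>2 * y = q ^ (Suc m)\<^sup>2"
  proof -
    have "m\<^sup>2 + (2 * m + 1) = (Suc m)\<^sup>2" by (simp add: power2_eq_square)
    thus ?thesis by (metis y_def power_add)
  qed
  finally show ?case unfolding qy .
qed

section \<open>Localisation at a polynomial\<close>

text \<open>The local ring itself is the case \<open>e = 0\<close>, so that integrality and
  divisibility by powers of \<open>P\<close> obey a single product rule.\<close>

definition local_ideal :: "rat poly \<Rightarrow> nat \<Rightarrow> ratfun set" where
  "local_ideal P e = {to_fract (P ^ e) * (to_fract U / to_fract V) | U V. V \<noteq> 0 \<and> coprime V P}"

definition lcong :: "rat poly \<Rightarrow> nat \<Rightarrow> ratfun \<Rightarrow> ratfun \<Rightarrow> bool" where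
  "lcong P e x y \<longleftrightarrow> x - y \<in> local_ideal P e"

text \<open>The condition \<open>x \<noteq> 0\<close> excludes 0, whose \<open>inverse\<close> is 0
  and lies in the ring.\<close>

definition lunit :: "rat poly \<Rightarrow> ratfun \<Rightarrow> bool" where
  "lunit P x \<longleftrightarrow> x \<noteq> 0 \<and> x \<in> local_ideal P 0 \<and> inverse x \<in> local_ideal P 0"

lemma local_idealI:
  "V \<noteq> 0 \<Longrightarrow> coprime V P \<Longrightarrow> x = to_fract (P ^ e) * (to_fract U / to_fract V) \<Longrightarrow> x \<in> local_ideal P e"
  unfolding local_ideal_def by blast

lemma local_idealE:
  assumes "x \<in> local_ideal P e"
  obtains U V where "V \<noteq> 0" "coprime V P" "x = to_fract (P ^ e) * (to_fract U / to_fract V)"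
  using assms unfolding local_ideal_def by blast

lemma local_ideal_add:
  assumes "x \<in> local_ideal P e" "y \<in> local_ideal P e"
  shows "x + y \<in> local_ideal P e"
proof -
  from assms(1) obtain U V where 1: "V \<noteq> 0" "coprime V P" "x = to_fract (P ^ e) * (to_fract U / to_fract V)"
    by (rule local_idealE)
  from assms(2) obtain U' V' where 2: "V' \<noteq> 0" "coprime V' P" "y = to_fract (P ^ e) * (to_fract U' / to_fract V')"
    by (rule local_idealE)
  show ?thesis
    by (rule local_idealI[of "V * V'" _ _ _ "U * V' + U' * V"])
      (use 1 2 in \<open>simp_all add: coprime_mult_left_iff divide_simps distrib_left mult_ac\<close>)
qed

lemma local_ideal_mult:
  assumes "x \<in> local_ideal P e" "y \<in> local_ideal P f"
  shows "x * y \<in> local_ideal P (e + f)"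
proof -
  from assms(1) obtain U V where 1: "V \<noteq> 0" "coprime V P" "x = to_fract (P ^ e) * (to_fract U / to_fract V)"
    by (rule local_idealE)
  from assms(2) obtain U' V' where 2: "V' \<noteq> 0" "coprime V' P" "y = to_fract (P ^ f) * (to_fract U' / to_fract V')"
    by (rule local_idealE)
  show ?thesis
    by (rule local_idealI[of "V * V'" _ _ _ "U * U'"])
      (use 1 2 in \<open>simp_all add: coprime_mult_left_iff power_add mult_ac\<close>)
qed

lemma to_fract_local_ideal: "P ^ e dvd U \<Longrightarrow> to_fract U \<in> local_ideal P e"
  by (elim dvdE, rule local_idealI[of 1 _ _ _ "U div P ^ e"]) (auto)

lemma to_fract_local_ring [simp, intro]: "to_fract U \<in> local_ideal P 0"
  by (rule to_fract_local_ideal) simp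

lemma local_ring_1 [simp]: "1 \<in> local_ideal P 0"
  using to_fract_local_ring[of 1] by simp

lemma local_ideal_0 [simp]: "0 \<in> local_ideal P e"
  using to_fract_local_ideal[of P e 0] by simp

lemma local_ideal_mult_left: "x \<in> local_ideal P 0 \<Longrightarrow> y \<in> local_ideal P e \<Longrightarrow> x * y \<in> local_ideal P e"
  using local_ideal_mult[of x P 0 y e] by simp

lemma local_ideal_mult_right: "x \<in> local_ideal P e \<Longrightarrow> y \<in> local_ideal P 0 \<Longrightarrow> x * y \<in> local_ideal P e"
  using local_ideal_mult[of x P e y 0] by simp

lemma local_ideal_uminus: "x \<in> local_ideal P e \<Longrightarrow> - x \<in> local_ideal P e"
  using local_ideal_mult_left[of "to_fract (-1)" P x e] to_fract_local_ring[of "-1" P] by simp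

lemma local_ideal_diff: "x \<in> local_ideal P e \<Longrightarrow> y \<in> local_ideal P e \<Longrightarrow> x - y \<in> local_ideal P e"
  using local_ideal_add[of x P e "- y"] local_ideal_uminus[of y P e] by simp

lemma local_ideal_sum: "(\<And>i. i \<in> A \<Longrightarrow> f i \<in> local_ideal P e) \<Longrightarrow> (\<Sum>i\<in>A. f i) \<in> local_ideal P e"
  by (induction A rule: infinite_finite_induct) (auto intro: local_ideal_add)

lemma local_ring_prod: "(\<And>i. i \<in> A \<Longrightarrow> f i \<in> local_ideal P 0) \<Longrightarrow> (\<Prod>i\<in>A. f i) \<in> local_ideal P 0"
  by (induction A rule: infinite_finite_induct) (auto intro: local_ideal_mult_left)

lemma local_ideal_power: "x \<in> local_ideal P e \<Longrightarrow> x ^ k \<in> local_ideal P (e * k)"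
  by (induction k) (auto intro: local_ideal_mult)

lemma local_ring_power: "x \<in> local_ideal P 0 \<Longrightarrow> x ^ k \<in> local_ideal P 0"
  using local_ideal_power[of x P 0 k] by simp

lemma local_ideal_mono: "x \<in> local_ideal P e \<Longrightarrow> f \<le> e \<Longrightarrow> x \<in> local_ideal P f"
  using local_ideal_mult_right[of "to_fract (P ^ f)" P f]
  by (elim local_idealE, intro local_idealI[where U = "P ^ (e - f) * _"])
    (auto simp flip: power_add mult.assoc to_fract_mult)

lemmas local_ring_intros = local_ideal_add local_ideal_diff local_ideal_uminus local_ideal_mult_left
  local_ring_power local_ideal_sum local_ring_prod

lemma lunit_to_fract: "V \<noteq> 0 \<Longrightarrow> coprime V P \<Longrightarrow> lunit P (to_fract V)"
  unfolding lunit_def using local_idealI[of V P "inverse (to_fract V)" 0 1]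
  by (auto simp: divide_simps)

lemma lunit_mult: "lunit P x \<Longrightarrow> lunit P y \<Longrightarrow> lunit P (x * y)"
  unfolding lunit_def by (auto intro: local_ideal_mult_left)

lemma lunit_1: "lunit P 1"
  using lunit_to_fract[of 1] by simp

lemma lunit_uminus: "lunit P x \<Longrightarrow> lunit P (- x)"
  by (simp add: lunit_def local_ideal_uminus)

lemma lunit_inverse: "lunit P x \<Longrightarrow> lunit P (inverse x)"
  unfolding lunit_def by auto

lemma lunit_divide: "lunit P x \<Longrightarrow> lunit P y \<Longrightarrow> lunit P (x / y)"
  unfolding divide_inverse by (intro lunit_mult lunit_inverse)

lemma lunit_power: "lunit P x \<Longrightarrow> lunit P (x ^ k)"
  by (induction k) (auto intro: lunit_mult lunit_1)

lemma lunit_prod: "(\<And>i. i \<in> A \<Longrightarrow> lunit P (f i)) \<Longrightarrow> lunit P (\<Prod>i\<in>A. f i)"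
  by (induction A rule: infinite_finite_induct) (auto intro: lunit_mult lunit_1)

lemma lunit_local_ring: "lunit P x \<Longrightarrow> x \<in> local_ideal P 0"
  by (simp add: lunit_def)

lemma lunit_nonzero: "lunit P x \<Longrightarrow> x \<noteq> 0"
  by (simp add: lunit_def)

lemma local_ideal_divide: "x \<in> local_ideal P e \<Longrightarrow> lunit P u \<Longrightarrow> x / u \<in> local_ideal P e"
  unfolding divide_inverse lunit_def by (auto intro: local_ideal_mult_right)

lemma lcong_refl [simp, intro]: "lcong P e x x"
  by (simp add: lcong_def)

lemma lcong_sym: "lcong P e x y \<Longrightarrow> lcong P e y x"
  unfolding lcong_def using local_ideal_uminus[of "x - y" P e] by simp

lemma lcong_trans [trans]: "lcong P e x y \<Longrightarrow> lcong P e y z \<Longrightarrow> lcong P e x z"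
  unfolding lcong_def using local_ideal_add[of "x - y" P e "y - z"] by simp

lemma lcong_add: "lcong P e x y \<Longrightarrow> lcong P e x' y' \<Longrightarrow> lcong P e (x + x') (y + y')"
  unfolding lcong_def using local_ideal_add[of "x - y" P e "x' - y'"] by (simp add: algebra_simps)

lemma lcong_uminus: "lcong P e x y \<Longrightarrow> lcong P e (- x) (- y)"
  unfolding lcong_def using local_ideal_uminus[of "x - y" P e] by (simp add: algebra_simps)

lemma lcong_diff: "lcong P e x y \<Longrightarrow> lcong P e x' y' \<Longrightarrow> lcong P e (x - x') (y - y')"
  using lcong_add[of P e x y "- x'" "- y'"] lcong_uminus[of P e x' y'] by simp

lemma lcong_sum: "(\<And>i. i \<in> A \<Longrightarrow> lcong P e (f i) (g i)) \<Longrightarrow> lcong P e (\<Sum>i\<in>A. f i) (\<Sum>i\<in>A. g i)"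
  by (induction A rule: infinite_finite_induct) (auto intro: lcong_add)

lemma lcong_local_ring: "lcong P e x y \<Longrightarrow> x \<in> local_ideal P 0 \<longleftrightarrow> y \<in> local_ideal P 0"
  unfolding lcong_def
  using local_ideal_add[of "x - y" P 0 y] local_ideal_diff[of x P 0 "x - y"] local_ideal_mono[of "x - y" P e 0]
  by auto

text \<open>Congruence is defined between arbitrary rational functions, but respects products only
  inside the local ring.\<close>

lemma lcong_mult:
  assumes "lcong P e x y" "lcong P e x' y'" "y \<in> local_ideal P 0" "y' \<in> local_ideal P 0"
  shows "lcong P e (x * x') (y * y')"
proof -
  have "x' \<in> local_ideal P 0" using assms lcong_local_ring by blast
  hence "(x - y) * x' + y * (x' - y') \<in> local_ideal P e"
    using assms by (auto simp: lcong_def intro: local_ideal_add local_ideal_mult_right local_ideal_mult_left)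
  thus ?thesis by (simp add: lcong_def algebra_simps)
qed

lemma lcong_power: "lcong P e x y \<Longrightarrow> y \<in> local_ideal P 0 \<Longrightarrow> lcong P e (x ^ k) (y ^ k)"
  by (induction k) (auto intro: lcong_mult local_ring_power)

lemma lcong_divide:
  assumes "lcong P e x y" "lcong P e u v" "y \<in> local_ideal P 0" "lunit P u" "lunit P v"
  shows "lcong P e (x / u) (y / v)"
proof -
  have "((x - y) * v - y * (u - v)) / (u * v) \<in> local_ideal P e"
    using assms lunit_local_ring[of P v] by (auto simp: lcong_def intro!: local_ideal_divide local_ideal_diff
       local_ideal_mult_right[of "x - y"] local_ideal_mult_left[of y] lunit_mult)
  moreover have "x / u - y / v = ((x - y) * v - y * (u - v)) / (u * v)"
    using assms(4,5) by (simp add: lunit_def field_simps)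
  ultimately show ?thesis by (simp add: lcong_def)
qed

lemma lcong_0_iff: "lcong P e x 0 \<longleftrightarrow> x \<in> local_ideal P e"
  by (simp add: lcong_def)

lemma lcong_local_ideal: "lcong P e x y \<Longrightarrow> y \<in> local_ideal P e \<Longrightarrow> x \<in> local_ideal P e"
  by (metis lcong_0_iff lcong_trans)

section \<open>Gluing congruences for coprime moduli\<close>

text \<open>With \<open>x - y = N / D\<close> in lowest terms, a congruence modulo \<open>R\<close>
  forces \<open>R\<close> to divide \<open>N\<close> and to be coprime to \<open>D\<close>; both
  properties pass to a product of coprime moduli.\<close>

lemma ratfun_cong_coprime_mult:
  assumes "ratfun_cong x y P" "ratfun_cong x y Q" "coprime P Q"
  shows "ratfun_cong x y (P * Q)"
proof -
  obtain N D where ND: "x - y = to_fract N / to_fract D" "D \<noteq> 0" "coprime N D"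

    by (metis Fract_quot_of_fract Fract_conv_to_fract coprime_quot_of_fract snd_quot_of_fract_nonzero)
  have *: "R dvd N \<and> coprime D R" if "ratfun_cong x y R" for R
  proof -
    from that obtain U V where UV: "V \<noteq> 0" "coprime V R" "x - y = to_fract R * (to_fract U / to_fract V)"
      unfolding ratfun_cong_def by blast
    hence "to_fract (N * V) = to_fract (D * (R * U))"
      using ND by (simp add: divide_simps mult_ac)
    hence eq: "N * V = D * (R * U)" by (simp only: to_fract_eq_iff)
    have "R dvd N * V" unfolding eq by simp
    hence "R dvd N" using UV(2) by (simp add: coprime_commute coprime_dvd_mult_left_iff)
    have "D dvd N * V" unfolding eq by simp
    hence "D dvd V" using ND(3) by (simp add: coprime_commute coprime_dvd_mult_right_iff)
    hence "coprime D R" using UV(2) coprime_divisors[of D V R R] by simp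
    with \<open>R dvd N\<close> show ?thesis by blast
  qed
  have "P * Q dvd N" using *[OF assms(1)] *[OF assms(2)] assms(3) by (simp add: divides_mult)
  then obtain U where "N = P * Q * U" by (elim dvdE)
  moreover have "coprime D (P * Q)" using *[OF assms(1)] *[OF assms(2)] by simp
  ultimately show ?thesis using ND unfolding ratfun_cong_def
    by (intro exI[of _ U] exI[of _ D]) simp
qed

lemma ratfun_cong_prod:
  assumes "finite A" "\<And>i. i \<in> A \<Longrightarrow> ratfun_cong x y (f i)"
    "\<And>i j. i \<in> A \<Longrightarrow> j \<in> A \<Longrightarrow> i \<noteq> j \<Longrightarrow> coprime (f i) (f j)"
  shows "ratfun_cong x y (\<Prod>i\<in>A. f i)"
  using assms
proof (induction A rule: finite_induct)
  case empty
  obtain N D where ND: "x - y = to_fract N / to_fract D" "D \<noteq> 0"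
    by (metis Fract_quot_of_fract Fract_conv_to_fract snd_quot_of_fract_nonzero)
  thus ?case unfolding ratfun_cong_def by (intro exI[of _ N] exI[of _ D]) simp
next
  case (insert a A)
  have "coprime (f a) (\<Prod>i\<in>A. f i)"
    by (rule prod_coprime_right) (use insert in auto)
  with insert show ?case by (auto intro: ratfun_cong_coprime_mult)
qed

lemma local_ideal_imp_ratfun_cong:
  "x - y \<in> local_ideal P e \<Longrightarrow> ratfun_cong x y (P ^ e)"
  unfolding ratfun_cong_def by (elim local_idealE) (metis coprime_power_right_iff)

section \<open>Cyclotomic polynomials and \<open>q\<close>-products\<close>

definition omq :: "nat \<Rightarrow> ratfun" where
  "omq j = 1 - ratfun_q ^ j"

lemma ratfun_q_power: "ratfun_q ^ j = to_fract (monom 1 j)"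
  by (induction j) (simp_all add: ratfun_q_def monom_Suc monom_eq_1 flip: to_fract_mult)

lemma omq_conv_to_fract: "omq j = to_fract (1 - monom 1 j)"
  by (simp add: omq_def ratfun_q_power)

lemma ratfun_q_nonzero [simp]: "ratfun_q \<noteq> 0"
  by (simp add: ratfun_q_def)

lemma omq_nonzero: "j > 0 \<Longrightarrow> omq j \<noteq> 0"
proof
  assume "j > 0" "omq j = 0"
  hence "1 - monom 1 j = (0 :: rat poly)"
    by (simp only: omq_conv_to_fract to_fract_eq_0_iff)
  hence "monom 1 j = (1 :: rat poly)" by simp
  from arg_cong[OF this, of degree] \<open>j > 0\<close> show False by (simp add: degree_monom_eq)
qed

lemma omq_0 [simp]: "omq 0 = 0"
  by (simp add: omq_def)

lemma omq_add: "omq (i + j) = omq i + ratfun_q ^ i * omq j"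
  by (simp add: omq_def power_add algebra_simps)

lemma map_poly_of_rat_one_minus_monom:
  "map_poly of_rat (1 - monom 1 j) = (1 - monom 1 j :: complex poly)"
  by (intro poly_eqI) (auto simp: coeff_map_poly of_rat_diff)

lemma map_poly_of_rat_one_plus_monom:
  "map_poly of_rat (1 + monom 1 j) = (1 + monom 1 j :: complex poly)"
  by (intro poly_eqI) (auto simp: coeff_map_poly of_rat_add)

lemma poly_cyclotomic_eq_0_iff:
  "n > 0 \<Longrightarrow> poly (map_poly of_rat (cyclotomic n)) z = 0 \<longleftrightarrow> z \<in> prim_roots_unity n"
  by (simp add: of_rat_cyclotomic poly_prod finite_prim_roots_unity)

lemma prim_root_power_eq_1_iff:
  assumes "z \<in> prim_roots_unity n" "n > 0"
  shows "z ^ j = 1 \<longleftrightarrow> n dvd j"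
proof
  assume "z ^ j = 1"
  have zn: "z ^ n = 1" using assms by (simp add: prim_roots_unity_def)
  have "z ^ j = (z ^ n) ^ (j div n) * z ^ (j mod n)"
    by (simp flip: power_mult power_add)
  hence "z ^ (j mod n) = 1" using zn \<open>z ^ j = 1\<close> by simp
  moreover have "j mod n < n" using assms by simp
  moreover have "\<forall>m. 0 < m \<and> m < n \<longrightarrow> z ^ m \<noteq> 1"
    using assms by (simp add: prim_roots_unity_def)
  ultimately have "j mod n = 0" by (metis gr0I)
  thus "n dvd j" by auto
next
  assume "n dvd j"
  thus "z ^ j = 1" using assms by (auto simp: prim_roots_unity_def power_mult)
qed

text \<open>A nonconstant gcd would have a complex root by the fundamental theorem of algebra, and
  this root would be common to both polynomials.\<close>

lemma coprime_rat_polyI: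
  fixes P Q :: "rat poly"
  assumes "\<And>z :: complex. poly (map_poly of_rat P) z = 0 \<Longrightarrow> poly (map_poly of_rat Q) z \<noteq> 0"
  shows "coprime P Q"
proof -
  define g where "g = gcd P Q"
  obtain P' Q' where PQ: "P = g * P'" "Q = g * Q'"
    unfolding g_def by (meson dvdE gcd_dvd1 gcd_dvd2)
  have nz: "poly (map_poly of_rat g) z \<noteq> (0 :: complex)" for z
    using assms[of z] unfolding PQ by (auto simp: map_poly_of_rat_mult)
  have "g \<noteq> 0" using nz by auto
  have "constant (poly (map_poly of_rat g :: complex poly))"
    using nz fundamental_theorem_of_algebra by blast
  hence "degree (map_poly of_rat g :: complex poly) = 0" by (simp add: constant_degree)
  hence "degree g = 0" by (simp add: degree_map_poly)
  hence "is_unit g" using \<open>g \<noteq> 0\<close> by (simp add: is_unit_iff_degree)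
  thus ?thesis unfolding g_def by (simp add: coprime_iff_gcd_eq_1)
qed

lemma coprime_cyclotomic:
  assumes "c > 0" "d > 0" "c \<noteq> d"
  shows "coprime (cyclotomic c) (cyclotomic d)"
  using prim_roots_unity_disjoint[of c d] assms
  by (intro coprime_rat_polyI) (auto simp: poly_cyclotomic_eq_0_iff)

lemma prod_cyclotomic:
  assumes "n > 0"
  shows "(\<Prod>d | d dvd n. cyclotomic d) = monom 1 n - 1"
proof -
  have "map_poly of_rat (\<Prod>d | d dvd n. cyclotomic d) =
      (\<Prod>d | d dvd n. \<Prod>z\<in>prim_roots_unity d. [:-z, 1:])"
    unfolding map_poly_of_rat_prod
    by (rule prod.cong) (simp_all add: of_rat_cyclotomic dvd_pos_nat[OF assms])
  also have "\<dots> = monom 1 n - (1 :: complex poly)" by (rule prod_prim_roots_unity[OF assms])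
  also have "\<dots> = map_poly of_rat (monom 1 n - 1)"
    by (intro poly_eqI) (auto simp: coeff_map_poly of_rat_diff)
  finally show ?thesis by (simp only: map_poly_of_rat_inj)
qed

lemma cyclotomic_1: "cyclotomic 1 = [:-1, 1:]"
proof -
  have "prim_roots_unity 1 = {1}" by (auto simp: prim_roots_unity_def)
  hence "map_poly of_rat (cyclotomic 1) = ([:-1, 1:] :: complex poly)"
    using of_rat_cyclotomic[of 1] by simp
  also have "\<dots> = map_poly of_rat [:-1, 1:]" by (simp add: map_poly_pCons)
  finally show ?thesis by (simp only: map_poly_of_rat_inj)
qed

text \<open>The factor for \<open>d = 1\<close> is \<open>q - 1\<close>, which is what
  \<open>[n]\<close> lacks compared with \<open>q^n - 1\<close>. This splits the modulus
  \<open>[n]\<close> into pairwise coprime factors.\<close>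

lemma qint_eq_prod_cyclotomic:
  assumes "n > 0"
  shows "qint [:0, 1:] n = (\<Prod>d\<in>{d. d dvd n} - {1}. cyclotomic d)"
proof -
  have "[:-1, 1:] * qint [:0, 1:] n = [:0, 1 :: rat:] ^ n - 1"
    unfolding qint_def using power_diff_1_eq[of "[:0, 1 :: rat:]" n]
    by (simp add: one_pCons)
  also have "[:0, 1 :: rat:] ^ n = monom 1 n" by (simp add: monom_altdef)
  also have "monom 1 n - 1 = cyclotomic 1 * (\<Prod>d\<in>{d. d dvd n} - {1}. cyclotomic d)"
    unfolding prod_cyclotomic[OF assms, symmetric]
    by (rule prod.remove) (use assms in auto)
  finally show ?thesis unfolding cyclotomic_1 by (subst (asm) mult_left_cancel) simp_all
qed

lemma cyclotomic_dvd:
  assumes "n > 0" "n dvd j"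
  shows "cyclotomic n dvd 1 - monom 1 j"
proof (cases "j = 0")
  case False
  hence "cyclotomic n dvd (\<Prod>d | d dvd j. cyclotomic d)"
    using assms by (intro dvd_prodI) auto
  hence "cyclotomic n dvd - (monom 1 j - 1)"
    using False by (subst dvd_minus_iff) (simp add: prod_cyclotomic)
  thus ?thesis by simp
qed (simp add: monom_eq_1)

lemma omq_local_ideal:
  assumes "n > 0" "n dvd j"
  shows "omq j \<in> local_ideal (cyclotomic n) 1"
  unfolding omq_conv_to_fract
  by (rule to_fract_local_ideal) (use cyclotomic_dvd[OF assms] in simp)

lemma lunit_omq:
  assumes "n > 0" "\<not> n dvd j"
  shows "lunit (cyclotomic n) (omq j)"
  unfolding omq_conv_to_fract
proof (rule lunit_to_fract)
  show "1 - monom 1 j \<noteq> (0 :: rat poly)"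
    using omq_nonzero[of j] assms by (metis dvd_0_right gr0I omq_conv_to_fract to_fract_0)
  show "coprime (1 - monom 1 j) (cyclotomic n)"
    unfolding coprime_commute[of "1 - monom 1 j"]
    by (rule coprime_rat_polyI)
       (use assms in \<open>auto simp: poly_cyclotomic_eq_0_iff map_poly_of_rat_one_minus_monom
          poly_monom prim_root_power_eq_1_iff\<close>)
qed

text \<open>If \<open>z^n = 1\<close> with \<open>n\<close> odd, then \<open>z^j = -1\<close> would
  give \<open>1 = (z^n)^j = (-1)^n = -1\<close>.\<close>

lemma lunit_one_plus_power:
  assumes "odd n"
  shows "lunit (cyclotomic n) (1 + ratfun_q ^ j)"
proof -
  have n: "n > 0" using assms by (auto simp: odd_pos)
  have nz: "poly (map_poly of_rat (1 + monom 1 j)) z \<noteq> 0" if "z \<in> prim_roots_unity n" for z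
  proof
    assume "poly (map_poly of_rat (1 + monom 1 j)) z = 0"
    hence "z ^ j = -1"
      by (simp add: map_poly_of_rat_one_plus_monom poly_monom add_eq_0_iff)
    hence "(z ^ n) ^ j = -1"
      using assms by (simp add: mult.commute flip: power_mult)  (simp add: power_mult)
    moreover have "z ^ n = 1" using that by (simp add: prim_roots_unity_def)
    ultimately show False by simp
  qed
  have "1 + monom 1 j \<noteq> (0 :: rat poly)"
  proof
    assume "1 + monom 1 j = (0 :: rat poly)"
    hence "poly (1 + monom 1 j) (1 :: rat) = 0" by simp
    thus False by (simp add: poly_monom)
  qed
  moreover have "coprime (1 + monom 1 j) (cyclotomic n)"
    unfolding coprime_commute[of "1 + monom 1 j"]
    by (rule coprime_rat_polyI) (use nz n in \<open>auto simp: poly_cyclotomic_eq_0_iff\<close>)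
  ultimately have "lunit (cyclotomic n) (to_fract (1 + monom 1 j))" by (rule lunit_to_fract)
  thus ?thesis by (simp add: ratfun_q_power)
qed

lemma lunit_ratfun_q:
  assumes "n > 0"
  shows "lunit (cyclotomic n) ratfun_q"
proof -
  have "coprime [:0, 1:] (cyclotomic n)"
    unfolding coprime_commute[of "[:0, 1:]"]
    by (rule coprime_rat_polyI)
       (use assms in \<open>auto simp: poly_cyclotomic_eq_0_iff map_poly_pCons prim_roots_unity_def power_0_left\<close>)
  thus ?thesis unfolding ratfun_q_def by (intro lunit_to_fract) auto
qed

lemma ratfun_q_local_ring [simp]: "ratfun_q \<in> local_ideal P 0"
  by (simp add: ratfun_q_def)

lemma omq_local_ring [simp]: "omq j \<in> local_ideal P 0"
  unfolding omq_conv_to_fract by (rule to_fract_local_ring)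

section \<open>Gaussian binomial coefficients and integrality of the terms\<close>

text \<open>Gaussian binomials, given by the q-Pascal rule so that they are visibly polynomials in
  \<open>q\<close>; \<open>qbinom_mult_prod\<close> is the quotient formula cleared of
  denominators.\<close>

fun qbinom :: "'a::comm_semiring_1 \<Rightarrow> nat \<Rightarrow> nat \<Rightarrow> 'a" where
  "qbinom q n 0 = 1"
| "qbinom q 0 (Suc k) = 0"
| "qbinom q (Suc n) (Suc k) = qbinom q n k + q ^ Suc k * qbinom q n (Suc k)"

lemma qbinom_eq_0: "n < k \<Longrightarrow> qbinom q n k = 0"
  by (induction q n k rule: qbinom.induct) auto

lemma qbinom_mult_prod:
  "k \<le> n \<Longrightarrow> qbinom ratfun_q n k * (\<Prod>i<k. omq (i + 1)) * (\<Prod>i<n - k. omq (i + 1)) = (\<Prod>i<n. omq (i + 1))"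
proof (induction n arbitrary: k)
  case (Suc n)
  let ?F = "\<lambda>n. \<Prod>i<n. omq (i + 1)"
  show ?case
  proof (cases k)
    case (Suc l)
    have a: "qbinom ratfun_q n l * ?F (Suc l) * ?F (n - l) = omq (l + 1) * ?F n"
      using Suc.IH[of l] Suc.prems Suc by (simp add: mult_ac)
    have b: "qbinom ratfun_q n (Suc l) * ?F (Suc l) * ?F (n - l) = omq (n - l) * ?F n"
    proof (cases "l = n")
      case False
      hence "n - l = Suc (n - Suc l)" "Suc l \<le> n" using Suc.prems Suc by auto
      thus ?thesis using Suc.IH[of "Suc l"] by (simp only: prod.lessThan_Suc) (simp add: mult_ac)
    qed (simp add: qbinom_eq_0)
    have "qbinom ratfun_q (Suc n) k * ?F k * ?F (Suc n - k) =
        qbinom ratfun_q n l * ?F (Suc l) * ?F (n - l) +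
        ratfun_q ^ Suc l * (qbinom ratfun_q n (Suc l) * ?F (Suc l) * ?F (n - l))"
      unfolding Suc by (simp only: qbinom.simps diff_Suc_Suc) (simp only: algebra_simps)
    also have "\<dots> = (omq (l + 1) + ratfun_q ^ (l + 1) * omq (n - l)) * ?F n"
      unfolding a b by (simp add: algebra_simps)
    also have "omq (l + 1) + ratfun_q ^ (l + 1) * omq (n - l) = omq (n + 1)"
      using Suc.prems Suc omq_add[of "l + 1" "n - l"] by simp
    finally show ?thesis by (simp add: mult_ac)
  qed simp
qed simp

lemma qbinom_local_ring: "qbinom ratfun_q n k \<in> local_ideal P 0"
  by (induction ratfun_q n k rule: qbinom.induct)
     (simp_all add: local_ring_intros)

text \<open>This is \<open>(q; q^2)_k / (q^2; q^2)_k\<close>.\<close>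

definition qratio :: "nat \<Rightarrow> ratfun" where
  "qratio k = (\<Prod>i<k. omq (2 * i + 1) / omq (2 * i + 2))"

lemma qratio_0 [simp]: "qratio 0 = 1" by (simp add: qratio_def)

lemma qratio_Suc: "qratio (Suc k) = qratio k * (omq (2 * k + 1) / omq (2 * k + 2))" by (simp add: qratio_def)

text \<open>Uses \<open>(q; q^2)_k (q^2; q^2)_k = (q; q)_{2k}\<close> and
  \<open>(q^2; q^2)_k = (q; q)_k (-q; q)_k\<close>. For odd \<open>n\<close> the new denominator is
  a unit at \<open>cyclotomic n\<close>, so \<open>qratio k\<close> is integral there even when
  \<open>(q^2; q^2)_k\<close> is not a unit.\<close>

lemma qratio_conv_qbinom: "qratio k = qbinom ratfun_q (2 * k) k / (\<Prod>i<k. 1 + ratfun_q ^ (i + 1)) ^ 2"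
proof -
  define Od Ev F M where "Od = (\<Prod>i<k. omq (2 * i + 1))" and "Ev = (\<Prod>i<k. omq (2 * i + 2))"
    and "F = (\<Prod>i<k. omq (i + 1))" and "M = (\<Prod>i<k. 1 + ratfun_q ^ (i + 1))"
  have "(\<Prod>i<2 * k. omq (i + 1)) = Od * Ev"
    unfolding Od_def Ev_def by (induction k) (simp_all add: mult_ac)
  hence 1: "qbinom ratfun_q (2 * k) k * F * F = Od * Ev"
    using qbinom_mult_prod[of k "2 * k"] by (simp add: F_def)
  have 2: "Ev = F * M"
    unfolding Ev_def F_def M_def prod.distrib[symmetric]
    by (intro prod.cong refl)
       (simp add: omq_def algebra_simps flip: power_add mult_2)
  have "Ev \<noteq> 0" unfolding Ev_def by (simp add: omq_nonzero)
  have "qratio k = Od / Ev" by (simp add: qratio_def Od_def Ev_def prod_dividef)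
  also have "\<dots> = qbinom ratfun_q (2 * k) k / M ^ 2"
    using 1 \<open>Ev \<noteq> 0\<close> unfolding 2 by (simp add: field_simps power2_eq_square)
  finally show ?thesis unfolding M_def .
qed

lemma qratio_local_ring: "odd n \<Longrightarrow> qratio k \<in> local_ideal (cyclotomic n) 0"
  unfolding qratio_conv_qbinom
  by (intro local_ideal_divide qbinom_local_ring lunit_power lunit_prod lunit_one_plus_power)

lemma qint_ratfun: "qint ratfun_q m = omq m / omq 1"
  using omq_nonzero[of 1] power_diff_1_eq[of ratfun_q m]
  by (simp add: qint_def omq_def field_simps)

lemma cq_conv_qratio: "cq k = (-1) ^ k * ratfun_q ^ k\<^sup>2 * (omq (4 * k + 1) / omq 1) * qratio k ^ 3"
proof -
  have r: "qpoch ratfun_q (ratfun_q\<^sup>2) k / qpoch (ratfun_q\<^sup>2) (ratfun_q\<^sup>2) k = qratio k"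
    unfolding qpoch_def qratio_def prod_dividef[symmetric]
  proof (intro prod.cong refl)
    fix i
    have "ratfun_q * (ratfun_q\<^sup>2) ^ i = ratfun_q ^ (2 * i + 1)"
      "ratfun_q\<^sup>2 * (ratfun_q\<^sup>2) ^ i = ratfun_q ^ (2 * i + 2)"
      unfolding power_add power_mult power_one_right by (rule mult.commute)+
    thus "(1 - ratfun_q * (ratfun_q\<^sup>2) ^ i) / (1 - ratfun_q\<^sup>2 * (ratfun_q\<^sup>2) ^ i) =
        omq (2 * i + 1) / omq (2 * i + 2)"
      by (simp only: omq_def)
  qed
  show ?thesis unfolding cq_def Let_def qint_ratfun power_divide[symmetric] r ..
qed

section \<open>Congruences modulo one cyclotomic polynomial\<close>

lemma lcong_prod:
  "(\<And>i. i \<in> A \<Longrightarrow> lcong P e (f i) (g i)) \<Longrightarrow> (\<And>i. i \<in> A \<Longrightarrow> g i \<in> local_ideal P 0) \<Longrightarrow>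
   lcong P e (\<Prod>i\<in>A. f i) (\<Prod>i\<in>A. g i)"
  by (induction A rule: infinite_finite_induct) (auto intro!: lcong_mult local_ring_prod)

lemma lunit_2: "lunit P 2"
proof -
  have "is_unit (2 :: rat poly)" by (simp add: is_unit_iff_degree)
  hence "lunit P (to_fract 2)"
    by (intro lunit_to_fract) (auto intro: is_unit_left_imp_coprime)
  also have "to_fract 2 = (2 :: ratfun)"
    by (simp only: one_add_one[symmetric] to_fract_add to_fract_1)
  finally show ?thesis .
qed

text \<open>Reversing the sum \<open>S\<close> gives \<open>S\<close> congruent to
  \<open>-S\<close>, and 2 is a unit.\<close>

lemma antisymmetric_sum_local_ideal:
  fixes f :: "nat \<Rightarrow> ratfun"
  assumes "\<And>k. k \<le> m \<Longrightarrow> lcong P e (f (m - k)) (- f k)"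
  shows "(\<Sum>k\<le>m. f k) \<in> local_ideal P e"
proof -
  let ?S = "\<Sum>k\<le>m. f k"
  have "?S = (\<Sum>k\<le>m. f (m - k))" by (rule sum.nat_diff_reindex[symmetric, of _ "Suc m", unfolded lessThan_Suc_atMost, simplified])
  also have "lcong P e \<dots> (\<Sum>k\<le>m. - f k)" by (intro lcong_sum assms) auto
  finally have "2 * ?S \<in> local_ideal P e" by (simp add: lcong_def sum_negf)
  hence "2 * ?S / 2 \<in> local_ideal P e" by (rule local_ideal_divide[OF _ lunit_2])
  thus ?thesis by simp
qed

text \<open>Here \<open>n\<close> is any odd number above 1; the locale is used for every divisor
  \<open>d > 1\<close> of the given modulus. For \<open>n = 1\<close> the denominator
  \<open>1 - q\<close> of the q-integers would not be a unit.\<close>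

locale odd_modulus =
  fixes n m :: nat
  assumes n_eq: "n = 2 * m + 1" and m_pos: "m > 0"
begin

abbreviation P :: "rat poly" where "P \<equiv> cyclotomic n"
abbreviation cong1 :: "ratfun \<Rightarrow> ratfun \<Rightarrow> bool" (infix "\<simeq>" 50) where
  "x \<simeq> y \<equiv> lcong P 1 x y"

lemma n_pos: "n > 0" and odd_n: "odd n" and n_gt_1: "n > 1"
  using n_eq m_pos by auto

lemma unit_q [simp, intro]: "lunit P ratfun_q"
  by (rule lunit_ratfun_q[OF n_pos])

lemma unit_q_power [simp, intro]: "lunit P (ratfun_q ^ j)"
  by (intro lunit_power unit_q)

lemma unit_omq: "\<not> n dvd j \<Longrightarrow> lunit P (omq j)"
  by (rule lunit_omq[OF n_pos])

lemma unit_omq_less: "0 < j \<Longrightarrow> j < n \<Longrightarrow> lunit P (omq j)"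
  by (rule unit_omq) (auto dest: dvd_imp_le)

lemma unit_omq_1 [simp, intro]: "lunit P (omq 1)" "lunit P (omq (Suc 0))"
  using unit_omq_less[of 1] n_gt_1 by auto

lemma omq_ideal: "n dvd j \<Longrightarrow> omq j \<in> local_ideal P 1"
  by (rule omq_local_ideal[OF n_pos])

lemma reg_qratio [simp, intro]: "qratio k \<in> local_ideal P 0"
  by (rule qratio_local_ring[OF odd_n])

lemma reg_minus_one_power [simp, intro]: "(-1) ^ k \<in> local_ideal P 0"
  by (intro local_ring_power local_ideal_uminus local_ring_1)

lemma reg_q_power [simp, intro]: "ratfun_q ^ k \<in> local_ideal P 0"
  by (intro local_ring_power ratfun_q_local_ring)

lemmas regs = local_ideal_mult_left local_ideal_divide local_ideal_add local_ideal_diff local_ideal_uminus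
   local_ring_power reg_minus_one_power reg_q_power reg_qratio omq_local_ring ratfun_q_local_ring local_ring_1
   unit_q unit_q_power unit_omq_1 lunit_mult lunit_power lunit_divide

lemma reg_cq [simp, intro]: "cq k \<in> local_ideal P 0"
  unfolding cq_conv_qratio by (intro regs)

lemma q_power_cong:
  assumes "i mod n = j mod n"
  shows "ratfun_q ^ i \<simeq> ratfun_q ^ j"
proof -
  have *: "ratfun_q ^ i \<simeq> ratfun_q ^ (i + n * k)" for i k
  proof -
    have "ratfun_q ^ i * omq (n * k) \<in> local_ideal P 1"
      by (intro local_ideal_mult_left reg_q_power omq_ideal) simp
    thus ?thesis by (simp add: lcong_def omq_def power_add algebra_simps)
  qed
  have "ratfun_q ^ (i mod n) \<simeq> ratfun_q ^ i" for i
    using *[of "i mod n" "i div n"] by simp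
  thus ?thesis by (metis assms lcong_trans lcong_sym)
qed

lemma omq_cong: "i mod n = j mod n \<Longrightarrow> omq i \<simeq> omq j"
  unfolding omq_def by (intro lcong_diff q_power_cong) auto

lemma q_power_reflect:
  assumes "n dvd i + j"
  shows "ratfun_q ^ j \<simeq> 1 / ratfun_q ^ i"
proof -
  have "- (omq (i + j) / ratfun_q ^ i) \<in> local_ideal P 1"
    using assms by (intro local_ideal_uminus local_ideal_divide omq_ideal unit_q_power)
  moreover have "ratfun_q ^ j - 1 / ratfun_q ^ i = - (omq (i + j) / ratfun_q ^ i)"
    by (simp add: omq_def power_add field_simps)
  ultimately show ?thesis by (simp add: lcong_def)
qed

lemma omq_reflect:
  assumes "n dvd i + j"
  shows "omq j \<simeq> - omq i / ratfun_q ^ i"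
proof -
  have "omq j \<simeq> 1 - 1 / ratfun_q ^ i"
    unfolding omq_def[of j] by (intro lcong_diff q_power_reflect assms lcong_refl)
  also have "1 - 1 / ratfun_q ^ i = - omq i / ratfun_q ^ i"
    by (simp add: omq_def field_simps)
  finally show ?thesis .
qed

section \<open>Reflection of k into m - k\<close>

lemma unit_qratio: "k \<le> m \<Longrightarrow> lunit P (qratio k)"
  unfolding qratio_def by (intro lunit_prod lunit_divide unit_omq_less) (auto simp: n_eq)

text \<open>In the reversed numerator each odd exponent is \<open>n - (2 i + 2)\<close>, and
  \<open>1 - q^(n - j)\<close> is congruent to \<open>-(1 - q^j) / q^j\<close>. Hence numerator and
  denominator agree up to sign and the power of \<open>q\<close> with exponent
  \<open>2 + 4 + ... + 2 m = m (m + 1)\<close>.\<close>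

lemma qratio_m: "qratio m \<simeq> (-1) ^ m / ratfun_q ^ (m * (m + 1))"
proof -
  have u: "lunit P (omq (2 * i + 2))" if "i < m" for i
    using that by (intro unit_omq_less) (auto simp: n_eq)
  have ne: "(\<Prod>i<m. omq (2 * i + 2)) \<noteq> 0" by (simp add: omq_nonzero)
  have "(\<Prod>i<m. omq (2 * i + 1)) = (\<Prod>i<m. omq (2 * (m - Suc i) + 1))"
    by (rule prod.nat_diff_reindex[symmetric])
  also have "\<dots> \<simeq> (\<Prod>i<m. - omq (2 * i + 2) / ratfun_q ^ (2 * i + 2))"
  proof (rule lcong_prod)
    fix i assume "i \<in> {..<m}"
    hence "(2 * i + 2) + (2 * (m - Suc i) + 1) = n" by (auto simp: n_eq)
    thus "omq (2 * (m - Suc i) + 1) \<simeq> - omq (2 * i + 2) / ratfun_q ^ (2 * i + 2)"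
      by (intro omq_reflect) simp
  qed (intro regs)
  also have "\<dots> = (-1) ^ m * (\<Prod>i<m. omq (2 * i + 2)) / ratfun_q ^ (m * (m + 1))"
  proof -
    have "(\<Sum>i<m. 2 * i + 2) = m * (m + 1)" by (induction m) simp_all
    hence "(\<Prod>i<m. ratfun_q ^ (2 * i + 2)) = ratfun_q ^ (m * (m + 1))"
      by (simp only: power_sum[symmetric])
    moreover have "(\<Prod>i<m. - omq (2 * i + 2)) = (-1) ^ m * (\<Prod>i<m. omq (2 * i + 2))"
      by (induction m) simp_all
    ultimately show ?thesis by (simp only: prod_dividef)
  qed
  finally have "qratio m \<simeq> ((-1) ^ m * (\<Prod>i<m. omq (2 * i + 2)) / ratfun_q ^ (m * (m + 1))) / (\<Prod>i<m. omq (2 * i + 2))"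
    unfolding qratio_def prod_dividef
    by (intro lcong_divide lcong_refl lunit_prod u regs local_ring_prod) auto
  thus ?thesis using ne by simp
qed

text \<open>Induction on \<open>k\<close> from \<open>qratio_m\<close>: the last factor of
  \<open>qratio (Suc l)\<close> is divided out, and its odd and even exponents are reflected by
  \<open>(2 l + 2) + (2 k + 1) = (2 l + 1) + (2 k + 2) = n\<close>.\<close>

lemma qratio_reflect:
  "k + l = m \<Longrightarrow> qratio l \<simeq> (-1) ^ m * ratfun_q ^ k * qratio k / ratfun_q ^ (m * (m + 1))"
proof (induction k arbitrary: l)
  case 0
  thus ?case using qratio_m by simp
next
  case (Suc k)
  have nz: "omq (2 * l + 1) \<noteq> 0" "omq (2 * l + 2) \<noteq> 0" "omq (2 * k + 1) \<noteq> 0" "omq (2 * k + 2) \<noteq> 0"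
    by (rule omq_nonzero; simp)+
  have u: "lunit P (omq (2 * l + 1))" "lunit P (omq (2 * k + 2))"
    using Suc.prems by (intro unit_omq_less; simp add: n_eq)+
  have "qratio l = qratio (Suc l) * (omq (2 * l + 2) / omq (2 * l + 1))"
    using nz by (simp add: qratio_Suc)
  also have "\<dots> \<simeq> ((-1) ^ m * ratfun_q ^ k * qratio k / ratfun_q ^ (m * (m + 1))) *
     ((- omq (2 * k + 1) / ratfun_q ^ (2 * k + 1)) / (- omq (2 * k + 2) / ratfun_q ^ (2 * k + 2)))"
    using Suc.prems u lunit_mult[OF u(2), of "-1"]
    by (intro lcong_mult lcong_divide Suc.IH omq_reflect regs) (auto simp: n_eq lunit_1 lunit_uminus)
  also have "\<dots> = (-1) ^ m * ratfun_q ^ Suc k * qratio (Suc k) / ratfun_q ^ (m * (m + 1))"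
    using nz by (simp add: qratio_Suc mult_ac)
  finally show ?case .
qed

text \<open>Cubing \<open>qratio_reflect\<close> leaves signs, which combine to that of
  \<open>cq k\<close>, and powers of \<open>q\<close>, whose exponents agree modulo
  \<open>n\<close>. The remaining minus sign comes from the q-integers, as
  \<open>(4 k + 1) + (4 l + 1) = 2 n\<close>.\<close>

lemma cq_reflect:
  assumes "k + l = m"
  shows "cq l \<simeq> - cq k"
proof -
  let ?Q = "ratfun_q ^ (m * (m + 1))" and ?J = "4 * k + 1"
  have *: "(l\<^sup>2 + 3 * k) mod n = (k\<^sup>2 + 3 * (m * (m + 1)) + ?J) mod n"
  proof -
    have "k\<^sup>2 + 3 * (m * (m + 1)) + ?J = (l\<^sup>2 + 3 * k) + n * (m + k + 1)"
      unfolding n_eq assms[symmetric] by (simp add: power2_eq_square algebra_simps)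
    thus ?thesis by (simp only: mod_mult_self2)
  qed
  have sgn: "(-1) ^ l * ((-1) ^ m) ^ 3 = ((-1) ^ k :: ratfun)"
    unfolding assms[symmetric] by (simp add: minus_one_power_iff)
  have d: "n dvd ?J + (4 * l + 1)"
    by (rule dvdI[of _ _ 2]) (simp add: n_eq assms[symmetric])
  have "cq l \<simeq> (-1) ^ l * ratfun_q ^ l\<^sup>2 * ((- omq ?J / ratfun_q ^ ?J) / omq 1) *
      ((-1) ^ m * ratfun_q ^ k * qratio k / ?Q) ^ 3"
    unfolding cq_conv_qratio
    by (intro lcong_mult lcong_divide lcong_power qratio_reflect assms omq_reflect d lcong_refl regs)
  also have "\<dots> = - (((-1) ^ l * ((-1) ^ m) ^ 3) * (omq ?J / omq 1) * qratio k ^ 3 *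
      (ratfun_q ^ (l\<^sup>2 + 3 * k) / (ratfun_q ^ ?J * ?Q ^ 3)))"
    by (simp add: power_mult_distrib power_divide power_add power_mult mult_ac)
  also have "\<dots> \<simeq> - (((-1) ^ l * ((-1) ^ m) ^ 3) * (omq ?J / omq 1) * qratio k ^ 3 *
      (ratfun_q ^ (k\<^sup>2 + 3 * (m * (m + 1)) + ?J) / (ratfun_q ^ ?J * ?Q ^ 3)))"
    by (intro lcong_uminus lcong_mult lcong_divide q_power_cong * lcong_refl regs)
  also have "\<dots> = - cq k"
  proof -
    have e: "ratfun_q ^ (a + 3 * b + c) / (ratfun_q ^ c * (ratfun_q ^ b) ^ 3) = ratfun_q ^ a" for a b c
      by (simp add: power_add power_mult[symmetric] mult.commute[of b 3])
    show ?thesis unfolding sgn cq_conv_qratio e by (simp only: mult_minus_left mult_ac)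
  qed
  finally show ?thesis .
qed

section \<open>First-order expansion of the deformed sum\<close>

text \<open>
  \<open>logderiv k\<close> is the logarithmic derivative, at \<open>t = 0\<close>, of the product over \<open>i < k\<close> of
  \<open>((1 - q\<^bsup>2 i + 1\<^esup>)\<^sup>2 - q\<^bsup>2 i + 1\<^esup> t) / ((1 - q\<^bsup>2 i + 2\<^esup>)\<^sup>2 - q\<^bsup>2 i + 2\<^esup> t)\<close>.
\<close>

definition logderiv_term :: "nat \<Rightarrow> ratfun" where
  "logderiv_term j = ratfun_q ^ j / omq j ^ 2"

definition logderiv :: "nat \<Rightarrow> ratfun" where
  "logderiv k = (\<Sum>i<k. logderiv_term (2 * i + 2) - logderiv_term (2 * i + 1))"

lemma reg_logderiv_term: "\<not> n dvd j \<Longrightarrow> logderiv_term j \<in> local_ideal P 0"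
  unfolding logderiv_term_def by (intro regs unit_omq)

lemma reg_logderiv: "k \<le> m \<Longrightarrow> logderiv k \<in> local_ideal P 0"
  unfolding logderiv_def by (intro local_ideal_sum regs reg_logderiv_term) (auto simp: n_eq dest: dvd_imp_le)

text \<open>The function \<open>x / (1 - x)^2\<close> is invariant under \<open>x -> 1 / x\<close>,
  and \<open>q^j\<close> is congruent to \<open>1 / q^i\<close>.\<close>

lemma logderiv_term_reflect:
  assumes "n dvd i + j" "\<not> n dvd i"
  shows "logderiv_term j \<simeq> logderiv_term i"
proof -
  have j: "\<not> n dvd j"
  proof
    assume "n dvd j"
    with assms show False by (simp add: dvd_add_left_iff)
  qed
  have "logderiv_term j \<simeq> (1 / ratfun_q ^ i) / (- omq i / ratfun_q ^ i) ^ 2"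
    unfolding logderiv_term_def
    by (intro lcong_divide lcong_power q_power_reflect omq_reflect assms regs unit_omq j lunit_uminus)
  also have "\<dots> = logderiv_term i"
    by (simp add: logderiv_term_def power_divide power2_eq_square)
  finally show ?thesis .
qed

text \<open>The odd exponents below \<open>2 m\<close> are the reflections \<open>n - j\<close> of
  the even exponents \<open>j\<close> from 2 to \<open>2 m\<close>, so the two halves
  cancel.\<close>

lemma logderiv_m: "logderiv m \<simeq> 0"
proof -
  have "(\<Sum>i<m. logderiv_term (2 * i + 1)) = (\<Sum>i<m. logderiv_term (2 * (m - Suc i) + 1))"
    by (rule sum.nat_diff_reindex[symmetric])
  also have "\<dots> \<simeq> (\<Sum>i<m. logderiv_term (2 * i + 2))"
  proof (rule lcong_sum)
    fix i assume "i \<in> {..<m}"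
    hence i: "(2 * i + 2) + (2 * (m - Suc i) + 1) = n" "2 * i + 2 < n" by (auto simp: n_eq)
    hence "\<not> n dvd 2 * i + 2" by (auto dest: dvd_imp_le)
    thus "logderiv_term (2 * (m - Suc i) + 1) \<simeq> logderiv_term (2 * i + 2)"
      using i(1) by (intro logderiv_term_reflect) simp_all
  qed
  finally have "(\<Sum>i<m. logderiv_term (2 * i + 2)) - (\<Sum>i<m. logderiv_term (2 * i + 1)) \<simeq> 0"
    by (auto simp: lcong_def dest: local_ideal_uminus)
  thus ?thesis by (simp add: logderiv_def sum_subtractf)
qed

lemma logderiv_reflect: "k + l = m \<Longrightarrow> logderiv l \<simeq> logderiv k"
proof (induction k arbitrary: l)
  case 0
  thus ?case using logderiv_m by (simp add: logderiv_def)
next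
  case (Suc k)
  have nd: "\<not> n dvd 2 * k + 1" "\<not> n dvd 2 * k + 2"
    using Suc.prems by (auto simp: n_eq dest!: dvd_imp_le)
  have "logderiv l = logderiv (Suc l) - logderiv_term (2 * l + 2) + logderiv_term (2 * l + 1)"
    by (simp add: logderiv_def)
  also have "\<dots> \<simeq> logderiv k - logderiv_term (2 * k + 1) + logderiv_term (2 * k + 2)"
    using Suc.prems by (intro lcong_add lcong_diff Suc.IH logderiv_term_reflect nd) (auto simp: n_eq)
  also have "\<dots> = logderiv (Suc k)" by (simp add: logderiv_def)
  finally show ?case .
qed

lemma sum_cq_ideal: "(\<Sum>k\<le>m. cq k) \<in> local_ideal P 1"
  by (rule antisymmetric_sum_local_ideal) (intro cq_reflect, simp)

text \<open>Under reflection \<open>cq\<close> is antisymmetric and \<open>logderiv\<close>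
  symmetric. This sum is the linear coefficient in the expansion of the deformed sum.\<close>

lemma sum_cq_logderiv_ideal: "(\<Sum>k\<le>m. cq k * logderiv k) \<in> local_ideal P 1"
proof (rule antisymmetric_sum_local_ideal)
  fix k assume "k \<le> m"
  hence "cq (m - k) * logderiv (m - k) \<simeq> - cq k * logderiv k"
    by (intro lcong_mult cq_reflect logderiv_reflect regs reg_logderiv reg_cq) auto
  thus "cq (m - k) * logderiv (m - k) \<simeq> - (cq k * logderiv k)" by simp
qed

text \<open>The value of \<open>t = (1 - y)^2 / y\<close> at \<open>y = q^n\<close>.\<close>

definition deform :: ratfun where
  "deform = omq n ^ 2 / ratfun_q ^ n"

lemma deform_ideal: "deform \<in> local_ideal P 2"
  unfolding deform_def using local_ideal_power[OF omq_ideal[of n], of 2]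
  by (intro local_ideal_divide) (auto simp: numeral_2_eq_2)

lemma deform_sq_ideal: "deform ^ 2 \<in> local_ideal P 3"
  using local_ideal_power[OF deform_ideal, of 2] by (auto intro: local_ideal_mono)

lemma reg_deform: "deform \<in> local_ideal P 0"
  using deform_ideal by (rule local_ideal_mono) simp

text \<open>The second claim follows from the first: up to unit factors, the left-hand side is the
  product of \<open>omq (n + j)\<close> and \<open>omq (n - j)\<close>, and \<open>n\<close> divides
  neither exponent.\<close>

lemma one_minus_deform_logderiv_term:
  assumes "0 < j" "j < n"
  shows "(1 - ratfun_q ^ j * ratfun_q ^ n) * (ratfun_q ^ n - ratfun_q ^ j) =
      ratfun_q ^ n * omq j ^ 2 * (1 - deform * logderiv_term j)"
    and "lunit P (1 - deform * logderiv_term j)"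
proof -
  have nz: "omq j \<noteq> 0" using assms by (simp add: omq_nonzero)
  have "ratfun_q ^ n * omq j ^ 2 * (1 - deform * logderiv_term j) = ratfun_q ^ n * omq j ^ 2 - omq n ^ 2 * ratfun_q ^ j"
    using nz by (simp add: deform_def logderiv_term_def right_diff_distrib)
  also have "\<dots> = (1 - ratfun_q ^ j * ratfun_q ^ n) * (ratfun_q ^ n - ratfun_q ^ j)"
    unfolding omq_def by algebra
  finally show *: "(1 - ratfun_q ^ j * ratfun_q ^ n) * (ratfun_q ^ n - ratfun_q ^ j) =
      ratfun_q ^ n * omq j ^ 2 * (1 - deform * logderiv_term j)" ..
  have "ratfun_q ^ n - ratfun_q ^ j = - (ratfun_q ^ j * omq (n - j))"
    using assms by (simp add: omq_def right_diff_distrib flip: power_add)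
  hence "1 - deform * logderiv_term j = omq (j + n) * - (ratfun_q ^ j * omq (n - j)) / (ratfun_q ^ n * omq j ^ 2)"
  proof -
    have "1 - ratfun_q ^ j * ratfun_q ^ n = omq (j + n)" by (simp add: omq_def power_add)
    with * \<open>ratfun_q ^ n - ratfun_q ^ j = _\<close>
    have "omq (j + n) * - (ratfun_q ^ j * omq (n - j)) = ratfun_q ^ n * omq j ^ 2 * (1 - deform * logderiv_term j)"
      by (simp only:)
    thus ?thesis using nz by simp
  qed
  also have "lunit P \<dots>"
    using assms by (intro lunit_divide lunit_mult lunit_power lunit_uminus unit_q_power unit_omq unit_omq_less)
     (auto dest: dvd_imp_le simp: dvd_add_left_iff)
  finally show "lunit P (1 - deform * logderiv_term j)" .
qed

text \<open>
  With \<open>y = q\<^sup>n\<close> one has \<open>(1 - q\<^sup>j y) (1 - q\<^sup>j / y) = (1 - q\<^sup>j)\<^sup>2 - q\<^sup>j t\<close> for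
  \<open>t = (1 - y)\<^sup>2 / y\<close>, so that \<open>wz_term\<close> is a first-order perturbation of \<open>cq\<close>.
\<close>

lemma wz_term_cong:
  "k \<le> m \<Longrightarrow> lcong P 3 (wz_term ratfun_q (ratfun_q ^ n) k) (cq k * (1 + deform * logderiv k))"
proof -
  define W where "W = (\<lambda>k. \<Prod>i<k. (1 - deform * logderiv_term (2 * i + 1)) / (1 - deform * logderiv_term (2 * i + 2)))"
  have Wc: "lcong P 3 (W k) (1 + deform * logderiv k)" if "k \<le> m" for k
    using that
  proof (induction k)
    case 0
    show ?case by (simp add: W_def logderiv_def)
  next
    case (Suc k)
    define u v where "u = logderiv_term (2 * k + 1)" and "v = logderiv_term (2 * k + 2)"
    have lt: "2 * k + 1 < n" "2 * k + 2 < n" using Suc.prems by (auto simp: n_eq)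
    have reg: "u \<in> local_ideal P 0" "v \<in> local_ideal P 0" "logderiv k \<in> local_ideal P 0"
      unfolding u_def v_def using lt Suc.prems by (auto intro!: reg_logderiv_term reg_logderiv dest: dvd_imp_le)
    have un: "lunit P (1 - deform * v)" unfolding v_def by (rule one_minus_deform_logderiv_term) (use lt in auto)
    have "W (Suc k) = W k * ((1 - deform * u) / (1 - deform * v))" by (simp add: W_def u_def v_def)
    also have "lcong P 3 \<dots> ((1 + deform * logderiv k) * ((1 - deform * u) / (1 - deform * v)))"
      using Suc.prems by (intro lcong_mult Suc.IH lcong_refl regs reg reg_deform un) auto
    also have "lcong P 3 \<dots> (1 + deform * (logderiv k - u + v))"
    proof -
      \<comment> \<open>The error of the linearisation is an explicit multiple of
        \<open>deform ^ 2\<close>, which has order at least 3.\<close>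
      have "deform ^ 2 * ((logderiv k - u + v) * v - logderiv k * u) / (1 - deform * v) \<in> local_ideal P 3"
        by (intro local_ideal_divide un local_ideal_mult_right deform_sq_ideal regs reg)
      also have "deform ^ 2 * ((logderiv k - u + v) * v - logderiv k * u) / (1 - deform * v) =
         (1 + deform * logderiv k) * ((1 - deform * u) / (1 - deform * v)) - (1 + deform * (logderiv k - u + v))"
        using lunit_nonzero[OF un] by (simp add: divide_simps) algebra
      finally show ?thesis by (simp add: lcong_def)
    qed
    also have "logderiv k - u + v = logderiv (Suc k)" by (simp add: logderiv_def u_def v_def)
    finally show ?case .
  qed
  assume k: "k \<le> m"
  have "(\<Prod>i<k. (1 - ratfun_q ^ (2 * i + 1)) * (1 - ratfun_q ^ (2 * i + 1) * ratfun_q ^ n) *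
          (ratfun_q ^ n - ratfun_q ^ (2 * i + 1)) /
          ((1 - ratfun_q ^ (2 * i + 2)) * (1 - ratfun_q ^ (2 * i + 2) * ratfun_q ^ n) *
          (ratfun_q ^ n - ratfun_q ^ (2 * i + 2)))) =
      (\<Prod>i<k. (omq (2 * i + 1) / omq (2 * i + 2)) ^ 3 *
         ((1 - deform * logderiv_term (2 * i + 1)) / (1 - deform * logderiv_term (2 * i + 2))))"
  proof (intro prod.cong refl)
    fix i assume "i \<in> {..<k}"
    hence lt: "0 < 2 * i + 1" "2 * i + 1 < n" "0 < 2 * i + 2" "2 * i + 2 < n" using k by (auto simp: n_eq)
    show "(1 - ratfun_q ^ (2 * i + 1)) * (1 - ratfun_q ^ (2 * i + 1) * ratfun_q ^ n) *
          (ratfun_q ^ n - ratfun_q ^ (2 * i + 1)) /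
          ((1 - ratfun_q ^ (2 * i + 2)) * (1 - ratfun_q ^ (2 * i + 2) * ratfun_q ^ n) *
          (ratfun_q ^ n - ratfun_q ^ (2 * i + 2))) =
          (omq (2 * i + 1) / omq (2 * i + 2)) ^ 3 *
         ((1 - deform * logderiv_term (2 * i + 1)) / (1 - deform * logderiv_term (2 * i + 2)))"
      unfolding mult.assoc one_minus_deform_logderiv_term(1)[OF lt(1,2)] one_minus_deform_logderiv_term(1)[OF lt(3,4)]
      unfolding omq_def[symmetric]
      by (simp add: power3_eq_cube power2_eq_square mult_ac)
  qed
  also have "\<dots> = qratio k ^ 3 * W k"
    by (simp only: prod.distrib qratio_def W_def prod_power_distrib)
  finally have "wz_term ratfun_q (ratfun_q ^ n) k = cq k * W k"
    unfolding wz_term_def cq_conv_qratio by (simp only: mult.assoc omq_def power_one_right)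
  thus ?thesis
    using k by (auto intro!: lcong_mult Wc regs reg_deform reg_logderiv reg_cq)
qed

text \<open>The sum deformed at \<open>y = q^n\<close> is known exactly from \<open>wz_sum\<close>.
  It differs from the sum of \<open>cq\<close> by \<open>deform\<close>, of order 2, times a sum of
  order 1, up to order 3.\<close>

lemma sum_cq_cong:
  "lcong P 3 (\<Sum>k\<le>m. cq k) ((-1) ^ m * ratfun_q ^ m\<^sup>2 * (omq n / omq 1))"
proof -
  have "(\<Sum>k\<le>m. wz_term ratfun_q (ratfun_q ^ (2 * m + 1)) k) =
      (-1) ^ m * ratfun_q ^ m\<^sup>2 * ((1 - ratfun_q ^ (2 * m + 1)) / (1 - ratfun_q))"
    by (rule wz_sum) (use omq_nonzero in \<open>auto simp: omq_def\<close>)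
  hence "(-1) ^ m * ratfun_q ^ m\<^sup>2 * (omq n / omq 1) = (\<Sum>k\<le>m. wz_term ratfun_q (ratfun_q ^ n) k)"
    by (simp only: n_eq omq_def power_one_right)
  also have "lcong P 3 \<dots> (\<Sum>k\<le>m. cq k * (1 + deform * logderiv k))"
    by (intro lcong_sum wz_term_cong) auto
  also have "\<dots> = (\<Sum>k\<le>m. cq k) + deform * (\<Sum>k\<le>m. cq k * logderiv k)"
    by (simp add: distrib_left sum.distrib sum_distrib_left mult_ac)
  also have "lcong P 3 \<dots> (\<Sum>k\<le>m. cq k)"
    using local_ideal_mult[OF deform_ideal sum_cq_logderiv_ideal] by (simp add: lcong_def)
  finally show ?thesis by (rule lcong_sym)
qed

end

section \<open>Splitting the double sum at m\<close>

lemma sum_lessThan_add: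
  fixes f :: "nat \<Rightarrow> 'a::comm_monoid_add"
  shows "(\<Sum>i<a + b. f i) = (\<Sum>i<a. f i) + (\<Sum>i<b. f (a + i))"
  by (induction b) (simp_all add: add_ac)

lemma sum_convolution:
  fixes f :: "nat \<Rightarrow> 'a::comm_ring_1"
  shows "(\<Sum>k<n. \<Sum>j\<le>k. f j * f (k - j)) = (\<Sum>i<n. f i * (\<Sum>j<n - i. f j))"
proof -
  have "(\<Sum>k<n. \<Sum>j\<le>k. f j * f (k - j)) = (\<Sum>(i, j)\<in>{(i, j). i + j < n}. f i * f j)"
    by (rule sum.triangle_reindex[symmetric])
  also have "{(i, j). i + j < n} = Sigma {..<n} (\<lambda>i. {..<n - i})" by auto
  also have "(\<Sum>(i, j)\<in>\<dots>. f i * f j) = (\<Sum>i<n. \<Sum>j<n - i. f i * f j)"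
    by (rule sum.Sigma[symmetric]) auto
  finally show ?thesis by (simp add: sum_distrib_left)
qed

text \<open>Pairs with both indices at most \<open>m\<close> satisfy \<open>i + j < 2 m + 1\<close>
  automatically and give the square. In every other admissible pair exactly one index exceeds
  \<open>m\<close>, and symmetry gives the factor 2.\<close>

lemma sum_convolution_split:
  fixes f :: "nat \<Rightarrow> 'a::comm_ring_1"
  shows "(\<Sum>i<2 * m + 1. f i * (\<Sum>j<2 * m + 1 - i. f j)) =
    (\<Sum>j\<le>m. f j)\<^sup>2 + 2 * (\<Sum>t<m. f (m + 1 + t) * (\<Sum>j<m - t. f j))"
proof -
  let ?R = "\<Sum>t<m. f (m + 1 + t) * (\<Sum>j<m - t. f j)"
  have "(\<Sum>i<(m + 1) + m. f i * (\<Sum>j<2 * m + 1 - i. f j)) =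
      (\<Sum>i<m + 1. f i * (\<Sum>j<2 * m + 1 - i. f j)) + ?R"
    unfolding sum_lessThan_add by (intro arg_cong2[where f = "(+)"] sum.cong refl) simp
  also have "(\<Sum>i<m + 1. f i * (\<Sum>j<2 * m + 1 - i. f j)) =
      (\<Sum>i<m + 1. f i * (\<Sum>j<m + 1. f j) + (\<Sum>t<m - i. f i * f (m + 1 + t)))"
  proof (intro sum.cong refl)
    fix i assume "i \<in> {..<m + 1}"
    hence "2 * m + 1 - i = (m + 1) + (m - i)" by simp
    thus "f i * (\<Sum>j<2 * m + 1 - i. f j) = f i * (\<Sum>j<m + 1. f j) + (\<Sum>t<m - i. f i * f (m + 1 + t))"
      by (simp only: sum_lessThan_add distrib_left sum_distrib_left)
  qed
  also have "\<dots> = (\<Sum>j\<le>m. f j)\<^sup>2 + (\<Sum>i<m + 1. \<Sum>t<m - i. f i * f (m + 1 + t))"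
    by (simp add: sum.distrib power2_eq_square sum_distrib_right lessThan_Suc_atMost del: sum.lessThan_Suc)
  also have "(\<Sum>i<m + 1. \<Sum>t<m - i. f i * f (m + 1 + t)) =
      (\<Sum>i<m + 1. \<Sum>t\<in>{t\<in>{..<m}. i + t < m}. f i * f (m + 1 + t))"
    by (intro sum.cong) auto
  also have "\<dots> = (\<Sum>t<m. \<Sum>i\<in>{i\<in>{..<m + 1}. i + t < m}. f i * f (m + 1 + t))"
    by (rule sum.swap_restrict) auto
  also have "\<dots> = ?R"
    unfolding sum_distrib_left by (intro sum.cong) (auto simp: mult.commute)
  finally have "(\<Sum>i<(m + 1) + m. f i * (\<Sum>j<2 * m + 1 - i. f j)) = (\<Sum>j\<le>m. f j)\<^sup>2 + 2 * ?R"
    by (simp only: mult_2 add.assoc)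
  moreover have "{..<2 * m + 1} = {..<(m + 1) + m}" by simp
  ultimately show ?thesis by (simp only:)
qed

section \<open>Terms above m and the congruence modulo the fourth power\<close>

context odd_modulus
begin

text \<open>For \<open>t < m\<close> the only factor of \<open>qratio (m + 1 + t)\<close> that is
  not a unit is \<open>omq n\<close> in the numerator; dividing it out leaves a unit.\<close>

definition qratio_residue :: "nat \<Rightarrow> ratfun" where
  "qratio_residue t = qratio (m + 1 + t) / omq n"

lemma omq_n_nonzero: "omq n \<noteq> 0"
  by (rule omq_nonzero[OF n_pos])

lemma qratio_residue_0: "qratio_residue 0 = qratio m / omq (n + 1)"
proof -
  have "2 * m + 1 = n" "2 * m + 2 = n + 1" by (simp_all add: n_eq)
  thus ?thesis using omq_n_nonzero by (simp add: qratio_residue_def qratio_Suc)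
qed

lemma qratio_residue_Suc: "qratio_residue (Suc t) = qratio_residue t * (omq (n + (2 * t + 2)) / omq (n + (2 * t + 3)))"
proof -
  have "2 * (m + 1 + t) + 1 = n + (2 * t + 2)" "2 * (m + 1 + t) + 2 = n + (2 * t + 3)"
    by (simp_all add: n_eq)
  thus ?thesis by (simp only: qratio_residue_def add_Suc_right qratio_Suc) simp
qed

lemma unit_omq_add: "0 < j \<Longrightarrow> j < n \<Longrightarrow> lunit P (omq (n + j))"
  by (rule unit_omq) (auto dest: dvd_imp_le simp: dvd_add_right_iff)

lemma omq_add_n: "omq (n + j) \<simeq> omq j"
  by (rule omq_cong) simp

lemma unit_qratio_residue: "t < m \<Longrightarrow> lunit P (qratio_residue t)"
proof (induction t)
  case 0
  show ?case unfolding qratio_residue_0 using n_gt_1 by (intro lunit_divide unit_qratio unit_omq_add) auto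
next
  case (Suc t)
  thus ?case unfolding qratio_residue_Suc
    by (intro lunit_divide lunit_mult Suc.IH unit_omq_add) (auto simp: n_eq)
qed

lemma qratio_residue_qratio: "t < m \<Longrightarrow> qratio_residue t * (qratio t * omq (2 * t + 1)) \<simeq> qratio_residue 0 * omq 1"
proof (induction t)
  case (Suc t)
  have nz: "omq (2 * t + 2) \<noteq> 0" "omq (2 * t + 3) \<noteq> 0" by (rule omq_nonzero; simp)+
  have u: "lunit P (omq (n + (2 * t + 3)))" "lunit P (omq (2 * t + 3))" "lunit P (omq (2 * t + 2))"
    using Suc.prems by (intro unit_omq_add unit_omq_less; simp add: n_eq)+
  have "qratio_residue (Suc t) * (qratio (Suc t) * omq (2 * Suc t + 1)) =
      (omq (n + (2 * t + 2)) / omq (n + (2 * t + 3))) * (qratio_residue t * (qratio t * omq (2 * t + 1)) * (omq (2 * t + 3) / omq (2 * t + 2)))"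
    unfolding qratio_residue_Suc qratio_Suc by (simp add: mult_ac eval_nat_numeral)
  also have "\<dots> \<simeq> (omq (2 * t + 2) / omq (2 * t + 3)) * (qratio_residue t * (qratio t * omq (2 * t + 1)) * (omq (2 * t + 3) / omq (2 * t + 2)))"
    using Suc.prems
    by (intro lcong_mult lcong_divide omq_add_n lcong_refl u regs lunit_local_ring[OF unit_qratio_residue]) simp_all
  also have "\<dots> = qratio_residue t * (qratio t * omq (2 * t + 1))"
    using nz by simp
  also have "\<dots> \<simeq> qratio_residue 0 * omq 1" using Suc by simp
  finally show ?case .
qed simp

text \<open>By \<open>qratio_residue_qratio\<close> the residue is a constant divided by
  \<open>qratio t * omq (2 * t + 1)\<close>, so it inherits the reflection of \<open>qratio\<close>,
  applied to \<open>t + 1\<close> and \<open>t'\<close> with sum \<open>m\<close>.\<close>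

lemma qratio_residue_reflect:
  assumes "t + t' + 1 = m"
  shows "qratio_residue t' \<simeq> - ((-1) ^ m) * ratfun_q ^ (m * (m + 1)) * ratfun_q ^ (t + 1) * qratio_residue t"
proof -
  let ?Q = "ratfun_q ^ (m * (m + 1))"
  define X X' where "X = qratio t * omq (2 * t + 1)" and "X' = qratio t' * omq (2 * t' + 1)"
  have u: "lunit P X" "lunit P X'"
    unfolding X_def X'_def using assms by (intro lunit_mult unit_qratio unit_omq_less; simp add: n_eq)+
  have u': "lunit P (omq (2 * t + 2))"
    using assms by (intro unit_omq_less) (auto simp: n_eq)
  have d: "n dvd (2 * t + 2) + (2 * t' + 1)"
    by (rule dvdI[of _ _ 1]) (simp add: n_eq assms[symmetric])
  have "X' \<simeq> ((-1) ^ m * ratfun_q ^ (t + 1) * qratio (t + 1) / ?Q) * (- omq (2 * t + 2) / ratfun_q ^ (2 * t + 2))"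
    unfolding X'_def using assms by (intro lcong_mult qratio_reflect omq_reflect d regs) auto
  also have "\<dots> = - ((-1) ^ m) * X / (?Q * ratfun_q ^ (t + 1))"
  proof -
    have "ratfun_q ^ (2 * t + 2) = ratfun_q ^ (t + 1) * ratfun_q ^ (t + 1)"
      by (simp add: mult_2 flip: power_add)
    thus ?thesis using lunit_nonzero[OF u'] by (simp add: X_def qratio_Suc mult_ac)
  qed
  finally have X': "X' \<simeq> - ((-1) ^ m) * X / (?Q * ratfun_q ^ (t + 1))" .
  have 1: "qratio_residue t' * X' \<simeq> qratio_residue t * X"
    unfolding X_def X'_def using assms qratio_residue_qratio[of t] qratio_residue_qratio[of t'] by (auto intro: lcong_trans lcong_sym)
  have "qratio_residue t' = (qratio_residue t' * X') / X'" using lunit_nonzero[OF u(2)] by simp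
  also have "\<dots> \<simeq> (qratio_residue t * X) / (- ((-1) ^ m) * X / (?Q * ratfun_q ^ (t + 1)))"
    using assms u
    by (intro lcong_divide 1 X' regs lunit_local_ring[OF unit_qratio_residue] lunit_local_ring[OF u(1)] lunit_uminus lunit_1) auto
  also have "\<dots> = - ((-1) ^ m) * ?Q * ratfun_q ^ (t + 1) * qratio_residue t"
    using lunit_nonzero[OF u(1)] by (simp add: field_simps minus_one_power_iff)
  finally show ?thesis .
qed

text \<open>For \<open>m < i < n\<close> the term \<open>cq i\<close> vanishes to third order; \<open>cq_lead\<close> is its leading coefficient.\<close>

definition cq_lead :: "nat \<Rightarrow> ratfun" where
  "cq_lead t = (-1) ^ (m + 1 + t) * ratfun_q ^ (m + 1 + t)\<^sup>2 * (omq (4 * (m + 1 + t) + 1) / omq 1) * qratio_residue t ^ 3"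

lemma cq_conv_cq_lead: "cq (m + 1 + t) = omq n ^ 3 * cq_lead t"
  unfolding cq_conv_qratio cq_lead_def qratio_residue_def using omq_n_nonzero by (simp add: power_divide)

lemma reg_cq_lead: "t < m \<Longrightarrow> cq_lead t \<in> local_ideal P 0"
  unfolding cq_lead_def by (intro regs lunit_local_ring[OF unit_qratio_residue])

text \<open>The bookkeeping of \<open>cq_reflect\<close> for the indices \<open>m + 1 + t\<close>
  and \<open>m + 1 + t'\<close>: the arguments of their q-integers add up to \<open>6 n\<close>,
  which again yields the minus sign.\<close>

lemma cq_lead_reflect:
  assumes "t + t' + 1 = m"
  shows "cq_lead t' \<simeq> - cq_lead t"
proof -
  let ?J = "4 * (m + 1 + t) + 1" and ?M = "m * (m + 1)"
  let ?Q = "ratfun_q ^ ?M"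
  have lt: "t < m" "t' < m" using assms by auto
  have d: "n dvd ?J + (4 * (m + 1 + t') + 1)"
    by (rule dvdI[of _ _ 6]) (simp add: n_eq assms[symmetric])
  have *: "((m + 1 + t')\<^sup>2 + 3 * ?M + 3 * (t + 1)) mod n = ((m + 1 + t)\<^sup>2 + ?J) mod n"
  proof -
    have "(m + 1 + t')\<^sup>2 + 3 * ?M + 3 * (t + 1) = ((m + 1 + t)\<^sup>2 + ?J) + n * (3 * t')"
      unfolding n_eq assms[symmetric] by (simp add: power2_eq_square algebra_simps)
    thus ?thesis by (simp only: mod_mult_self2)
  qed
  have sgn: "(-1) ^ (m + 1 + t') * (- ((-1) ^ m)) ^ 3 = ((-1) ^ (m + 1 + t) :: ratfun)"
    unfolding assms[symmetric] by (simp add: minus_one_power_iff)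
  have "cq_lead t' \<simeq> (-1) ^ (m + 1 + t') * ratfun_q ^ (m + 1 + t')\<^sup>2 * ((- omq ?J / ratfun_q ^ ?J) / omq 1) *
      (- ((-1) ^ m) * ?Q * ratfun_q ^ (t + 1) * qratio_residue t) ^ 3"
    unfolding cq_lead_def
    by (intro lcong_mult lcong_divide lcong_power qratio_residue_reflect assms omq_reflect d lcong_refl regs
      lunit_local_ring[OF unit_qratio_residue] lt)
  also have "\<dots> = - (((-1) ^ (m + 1 + t') * (- ((-1) ^ m)) ^ 3) * (omq ?J / omq 1) * qratio_residue t ^ 3 *
      (ratfun_q ^ ((m + 1 + t')\<^sup>2 + 3 * ?M + 3 * (t + 1)) / ratfun_q ^ ?J))"
  proof -
    have "ratfun_q ^ ((m + 1 + t')\<^sup>2 + 3 * ?M + 3 * (t + 1)) =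
      ratfun_q ^ (m + 1 + t')\<^sup>2 * ?Q ^ 3 * (ratfun_q ^ (t + 1)) ^ 3"
      unfolding power_mult[symmetric] power_add[symmetric] by (simp only: mult.commute)
    moreover have "a * b * ((- w / p) / c) * (s * Q * r * x) ^ 3 =
        - ((a * s ^ 3) * (w / c) * x ^ 3 * ((b * Q ^ 3 * r ^ 3) / p))" for a b c p Q r s w x :: ratfun
      by (simp add: power_mult_distrib mult_ac)
    ultimately show ?thesis by (simp only:)
  qed
  also have "\<dots> \<simeq> - (((-1) ^ (m + 1 + t') * (- ((-1) ^ m)) ^ 3) * (omq ?J / omq 1) * qratio_residue t ^ 3 *
      (ratfun_q ^ ((m + 1 + t)\<^sup>2 + ?J) / ratfun_q ^ ?J))"
    by (intro lcong_uminus lcong_mult lcong_divide q_power_cong * lcong_refl regs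
      lunit_local_ring[OF unit_qratio_residue] lt)
  also have "\<dots> = - cq_lead t"
  proof -
    have e: "ratfun_q ^ ((m + 1 + t)\<^sup>2 + ?J) / ratfun_q ^ ?J = ratfun_q ^ (m + 1 + t)\<^sup>2"
      by (simp only: power_add) simp
    show ?thesis unfolding sgn cq_lead_def e by (simp only: mult_minus_left mult_ac)
  qed
  finally show ?thesis .
qed

text \<open>The sum up to \<open>m\<close> vanishes modulo \<open>P\<close>, and what follows its
  first \<open>t + 1\<close> terms is the negated reflection of the first \<open>t' + 1\<close>
  terms.\<close>

lemma cq_partial_sum_reflect:
  assumes "t + t' + 1 = m"
  shows "(\<Sum>j<t + 1. cq j) \<simeq> (\<Sum>j<t' + 1. cq j)"
proof -
  have "(\<Sum>j\<le>m. cq j) = (\<Sum>j<(t + 1) + (t' + 1). cq j)"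
    using assms by (intro sum.cong) auto
  also have "\<dots> = (\<Sum>j<t + 1. cq j) + (\<Sum>j<t' + 1. cq (t + 1 + j))"
    by (rule sum_lessThan_add)
  also have "(\<Sum>j<t' + 1. cq (t + 1 + j)) = (\<Sum>j<t' + 1. cq (t + 1 + (t' + 1 - Suc j)))"
    by (rule sum.nat_diff_reindex[symmetric])
  also have "(\<Sum>j<t + 1. cq j) + \<dots> \<simeq> (\<Sum>j<t + 1. cq j) + (\<Sum>j<t' + 1. - cq j)"
  proof (intro lcong_add lcong_refl lcong_sum cq_reflect)
    fix j assume "j \<in> {..<t' + 1}"
    thus "j + (t + 1 + (t' + 1 - Suc j)) = m" using assms by auto
  qed
  also have "\<dots> = (\<Sum>j<t + 1. cq j) - (\<Sum>j<t' + 1. cq j)"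
    by (simp add: sum_negf)
  finally show ?thesis
    using sum_cq_ideal by (metis lcong_def lcong_local_ideal lcong_sym)
qed

text \<open>Under \<open>t -> m - 1 - t\<close> the leading coefficients are antisymmetric and the
  partial sums symmetric.\<close>

lemma sum_cq_lead_ideal: "(\<Sum>t<m. cq_lead t * (\<Sum>j<m - t. cq j)) \<in> local_ideal P 1"
proof -
  obtain M where M: "m = Suc M" using m_pos by (cases m) auto
  have "(\<Sum>t\<le>M. cq_lead t * (\<Sum>j<m - t. cq j)) \<in> local_ideal P 1"
  proof (rule antisymmetric_sum_local_ideal)
    fix t assume t: "t \<le> M"
    define t' where "t' = M - t"
    have idx: "t + t' + 1 = m" "t' + 1 = m - t" "t + 1 = m - t'" using t by (auto simp: t'_def M)
    have "cq_lead t' * (\<Sum>j<t + 1. cq j) \<simeq> - cq_lead t * (\<Sum>j<t' + 1. cq j)"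
      using idx(1) by (intro lcong_mult cq_lead_reflect cq_partial_sum_reflect regs reg_cq_lead local_ideal_sum reg_cq) auto
    thus "cq_lead (M - t) * (\<Sum>j<m - (M - t). cq j) \<simeq> - (cq_lead t * (\<Sum>j<m - t. cq j))"
      unfolding t'_def[symmetric] idx(2,3)[symmetric] by (simp only: mult_minus_left)
  qed
  thus ?thesis unfolding M lessThan_Suc_atMost .
qed

text \<open>In \<open>A^2 - E^2 = (A - E) (A + E)\<close> the factors have orders 3 and 1; the mixed
  terms carry \<open>omq n ^ 3\<close> times a sum of order 1.\<close>

lemma convolution_cong:
  "lcong P 4 (\<Sum>i<n. cq i * (\<Sum>j<n - i. cq j)) (ratfun_q ^ (2 * m\<^sup>2) * (omq n / omq 1) ^ 2)"
proof -
  define A E where "A = (\<Sum>k\<le>m. cq k)" and "E = (-1) ^ m * ratfun_q ^ m\<^sup>2 * (omq n / omq 1)"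
  have A: "A - E \<in> local_ideal P 3" "A \<in> local_ideal P 1"
    using sum_cq_cong sum_cq_ideal by (simp_all add: A_def E_def lcong_def)
  have E: "E \<in> local_ideal P 1"
    unfolding E_def by (intro local_ideal_mult_left local_ideal_divide omq_ideal regs) simp
  have "(A - E) * (A + E) \<in> local_ideal P (3 + 1)"
    by (intro local_ideal_mult A local_ideal_add E)
  moreover have "omq n ^ 3 * (\<Sum>t<m. cq_lead t * (\<Sum>j<m - t. cq j)) \<in> local_ideal P (1 * 3 + 1)"
    by (intro local_ideal_mult local_ideal_power omq_ideal sum_cq_lead_ideal) simp
  ultimately have "(A - E) * (A + E) + 2 * (omq n ^ 3 * (\<Sum>t<m. cq_lead t * (\<Sum>j<m - t. cq j))) \<in> local_ideal P 4"
    by (intro local_ideal_add local_ideal_mult_left[OF lunit_local_ring[OF lunit_2]]) simp_all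
  also have "(A - E) * (A + E) + 2 * (omq n ^ 3 * (\<Sum>t<m. cq_lead t * (\<Sum>j<m - t. cq j))) =
     (\<Sum>i<n. cq i * (\<Sum>j<n - i. cq j)) - E\<^sup>2"
    unfolding n_eq sum_convolution_split
    unfolding n_eq[symmetric] cq_conv_cq_lead A_def[symmetric] sum_distrib_left[of "omq n ^ 3"] mult.assoc
    by (simp only: power2_eq_square algebra_simps)
  also have "E\<^sup>2 = ratfun_q ^ (2 * m\<^sup>2) * (omq n / omq 1) ^ 2"
  proof -
    have "ratfun_q ^ (2 * m\<^sup>2) = (ratfun_q ^ m\<^sup>2)\<^sup>2" "((-1) ^ m)\<^sup>2 = (1 :: ratfun)"
      by (simp add: mult.commute flip: power_mult) (simp add: minus_one_power_iff)
    thus ?thesis by (simp only: E_def power_mult_distrib mult_1)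
  qed
  finally show ?thesis by (simp add: lcong_def)
qed

section \<open>Block structure and vanishing of the convolution modulo P\<close>

lemma not_dvd_double: "0 < j \<Longrightarrow> j < n \<Longrightarrow> \<not> n dvd 2 * (n * a + j)"
proof
  assume j: "0 < j" "j < n" "n dvd 2 * (n * a + j)"
  have "coprime n 2" using odd_n by (simp add: coprime_right_2_iff_odd)
  hence "n dvd n * a + j" using j(3) by (simp only: coprime_dvd_mult_right_iff)
  hence "n dvd j" by (simp add: dvd_add_right_iff)
  thus False using j by (auto dest: dvd_imp_le)
qed

text \<open>Modulo \<open>P\<close> the factors depend only on the exponents modulo
  \<open>n\<close>, and \<open>b < n\<close> keeps multiples of \<open>n\<close> out of the
  denominators.\<close>

lemma qratio_block: "b < n \<Longrightarrow> qratio (n * a + b) \<simeq> qratio (n * a) * qratio b"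
proof (induction b)
  case (Suc b)
  have e: "2 * (n * a + Suc b) = 2 * (n * a + b) + 2" "2 * (n * 0 + Suc b) = 2 * b + 2"
    by simp_all
  have u: "lunit P (omq (2 * (n * a + b) + 2))" "lunit P (omq (2 * b + 2))"
    using not_dvd_double[of "Suc b" a] not_dvd_double[of "Suc b" 0] Suc.prems unfolding e
    by (auto intro!: unit_omq)
  have c: "omq (2 * (n * a + b) + i) \<simeq> omq (2 * b + i)" for i
  proof (rule omq_cong)
    have "2 * (n * a + b) + i = (2 * b + i) + n * (2 * a)" by simp
    thus "(2 * (n * a + b) + i) mod n = (2 * b + i) mod n" by (simp only: mod_mult_self2)
  qed
  have "qratio (n * a + Suc b) = qratio (n * a + b) * (omq (2 * (n * a + b) + 1) / omq (2 * (n * a + b) + 2))"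
    by (simp only: add_Suc_right qratio_Suc)
  also have "\<dots> \<simeq> (qratio (n * a) * qratio b) * (omq (2 * b + 1) / omq (2 * b + 2))"
    using Suc by (intro lcong_mult lcong_divide c u regs) simp_all
  also have "\<dots> = qratio (n * a) * qratio (Suc b)" by (simp only: qratio_Suc mult.assoc)
  finally show ?case .
qed simp

text \<open>The other factors of \<open>cq (n * a)\<close>, a power of \<open>q^n\<close> and a
  q-integer, are congruent to 1 modulo \<open>P\<close>.\<close>

definition block_coeff :: "nat \<Rightarrow> ratfun" where
  "block_coeff a = (-1) ^ (n * a) * qratio (n * a) ^ 3"

lemma reg_block_coeff: "block_coeff a \<in> local_ideal P 0"
  unfolding block_coeff_def by (intro regs)

lemma cq_block:
  assumes "b < n"
  shows "cq (n * a + b) \<simeq> block_coeff a * cq b"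
proof -
  have 1: "(n * a + b)\<^sup>2 mod n = b\<^sup>2 mod n"
  proof -
    have "(n * a + b)\<^sup>2 = b\<^sup>2 + n * (n * a * a + 2 * a * b)"
      by (simp add: power2_eq_square algebra_simps)
    thus ?thesis by (simp only: mod_mult_self2)
  qed
  have 2: "(4 * (n * a + b) + 1) mod n = (4 * b + 1) mod n"
  proof -
    have "4 * (n * a + b) + 1 = (4 * b + 1) + n * (4 * a)" by simp
    thus ?thesis by (simp only: mod_mult_self2)
  qed
  have "cq (n * a + b) \<simeq> (-1) ^ (n * a + b) * ratfun_q ^ b\<^sup>2 * (omq (4 * b + 1) / omq 1) * (qratio (n * a) * qratio b) ^ 3"
    unfolding cq_conv_qratio
    by (intro lcong_mult lcong_divide lcong_power[where x = "qratio (n * a + b)"] q_power_cong omq_cong 1 2 qratio_block assms lcong_refl regs)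
  also have "\<dots> = block_coeff a * cq b"
    unfolding cq_conv_qratio block_coeff_def by (simp only: power_add power_mult_distrib mult_ac)
  finally show ?thesis .
qed

lemma cq_upper_half:
  assumes "m < b" "b < n"
  shows "cq b \<in> local_ideal P 1"
proof -
  define t where "t = b - (m + 1)"
  have t: "b = m + 1 + t" "t < m" using assms by (auto simp: t_def n_eq)
  have "omq n ^ 3 \<in> local_ideal P 1"
    using local_ideal_power[OF omq_ideal[of n], of 3] by (auto intro: local_ideal_mono)
  thus ?thesis unfolding t(1) cq_conv_cq_lead
    by (intro local_ideal_mult_right reg_cq_lead t(2))
qed

lemma sum_cq_upper_half:
  assumes "m < r" "r \<le> n"
  shows "(\<Sum>j<r. cq j) \<in> local_ideal P 1"
proof -
  have r: "r = (m + 1) + (r - (m + 1))" using assms by simp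
  have "(\<Sum>j<(m + 1) + (r - (m + 1)). cq j) \<in> local_ideal P 1"
  proof (subst sum_lessThan_add, rule local_ideal_add)
    show "(\<Sum>j<m + 1. cq j) \<in> local_ideal P 1"
      using sum_cq_ideal by (simp only: Suc_eq_plus1[symmetric] lessThan_Suc_atMost)
    show "(\<Sum>j<r - (m + 1). cq (m + 1 + j)) \<in> local_ideal P 1"
      using assms by (intro local_ideal_sum cq_upper_half) auto
  qed
  thus ?thesis using r by simp
qed

text \<open>Complete blocks sum to 0 modulo \<open>P\<close>; so does an initial piece longer than
  \<open>m\<close>, because it misses only vanishing terms.\<close>

lemma sum_cq_block_ideal:
  assumes "m < r" "r \<le> n"
  shows "(\<Sum>j<n * a + r. cq j) \<in> local_ideal P 1"
proof -
  have *: "(\<Sum>j<r. cq (n * a + j)) \<in> local_ideal P 1" if "m < r" "r \<le> n" for r a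
  proof (rule lcong_local_ideal)
    show "(\<Sum>j<r. cq (n * a + j)) \<simeq> (\<Sum>j<r. block_coeff a * cq j)"
      by (intro lcong_sum cq_block) (use that in auto)
    show "(\<Sum>j<r. block_coeff a * cq j) \<in> local_ideal P 1"
      unfolding sum_distrib_left[symmetric]
      by (intro local_ideal_mult_left reg_block_coeff sum_cq_upper_half that)
  qed
  have "(\<Sum>j<n * a. cq j) \<in> local_ideal P 1"
  proof (induction a)
    case (Suc a)
    have "n * Suc a = n * a + n" by simp
    thus ?case using Suc *[of n a] by (simp only: sum_lessThan_add local_ideal_add n_eq)
  qed simp
  thus ?thesis unfolding sum_lessThan_add by (intro local_ideal_add * assms)
qed

text \<open>Let \<open>b\<close> be the residue of \<open>i\<close> modulo \<open>n\<close>. Either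
  \<open>b > m\<close> and \<open>cq i\<close> vanishes modulo \<open>P\<close>, or the inner sum
  ends with a piece of length \<open>n - b > m\<close> of a block and vanishes by
  \<open>sum_cq_block_ideal\<close>.\<close>

lemma convolution_ideal:
  assumes "n dvd N"
  shows "(\<Sum>i<N. cq i * (\<Sum>j<N - i. cq j)) \<in> local_ideal P 1"
proof (rule local_ideal_sum)
  fix i assume i: "i \<in> {..<N}"
  define a b where "a = i div n" and "b = i mod n"
  have ab: "i = n * a + b" "b < n" using n_pos by (auto simp: a_def b_def)
  obtain M where M: "N = n * M" using assms by (elim dvdE)
  show "cq i * (\<Sum>j<N - i. cq j) \<in> local_ideal P 1"
  proof (cases "m < b")
    case True
    have "cq i \<in> local_ideal P 1"
      unfolding ab(1)
      by (rule lcong_local_ideal[OF cq_block])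
         (intro ab local_ideal_mult_left reg_block_coeff cq_upper_half True)+
    thus ?thesis by (intro local_ideal_mult_right local_ideal_sum reg_cq)
  next
    case False
    have "n * a + b < n * M" using i unfolding M ab(1) by simp
    hence "n * a < n * M" by (rule le_less_trans[OF le_add1])
    hence "a < M" by simp
    then obtain c where c: "M = a + 1 + c" by (metis add.commute less_imp_Suc_add plus_1_eq_Suc add.assoc)
    have "N - i = n * c + (n - b)" unfolding M c ab(1) using ab(2) by (simp add: algebra_simps)
    moreover have "m < n - b" using False by (simp add: n_eq)
    ultimately have "(\<Sum>j<N - i. cq j) \<in> local_ideal P 1"
      by (simp only:) (rule sum_cq_block_ideal; simp)
    thus ?thesis by (intro local_ideal_mult_left reg_cq)
  qed
qed

end

section \<open>Assembling the congruences over the divisors of n\<close>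

theorem theorem1p3:
  fixes n :: nat
  assumes "odd n"
  shows "ratfun_cong (\<Sum>k = 0..n - 1. \<Sum>j = 0..k. cq j * cq (k - j))
           (ratfun_q ^ ((n - 1)\<^sup>2 div 2) * qint ratfun_q n ^ 2)
           (qint [:0, 1:] n * cyclotomic n ^ 3)"
proof (cases "n = 1")
  \<comment> \<open>The locale excludes \<open>n = 1\<close>; here both sides equal 1.\<close>
  case True
  show ?thesis
    unfolding ratfun_cong_def True
    by (intro exI[of _ 0] exI[of _ 1]) (simp add: cq_conv_qratio qint_def omq_nonzero)
next
  case False
  have n: "n > 0" using assms by (auto simp: odd_pos)
  define m where "m = n div 2"
  have nm: "n = 2 * m + 1" using assms unfolding m_def by (auto elim!: oddE)
  define D R where "D = (\<Sum>i<n. cq i * (\<Sum>j<n - i. cq j))"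
    and "R = ratfun_q ^ (2 * m\<^sup>2) * (omq n / omq 1) ^ 2"
  have "(\<Sum>k = 0..n - 1. \<Sum>j = 0..k. cq j * cq (k - j)) = (\<Sum>k<n. \<Sum>j\<le>k. cq j * cq (k - j))"
    using n by (intro sum.cong) auto
  also have "\<dots> = D" unfolding D_def by (rule sum_convolution)
  finally have D: "(\<Sum>k = 0..n - 1. \<Sum>j = 0..k. cq j * cq (k - j)) = D" .
  have "(n - 1)\<^sup>2 div 2 = 2 * m\<^sup>2" by (simp add: nm power_mult_distrib)
  hence R: "ratfun_q ^ ((n - 1)\<^sup>2 div 2) * qint ratfun_q n ^ 2 = R"
    by (simp only: R_def qint_ratfun)
  \<comment> \<open>Since \<open>[n]\<close> already contains \<open>cyclotomic n\<close> once, the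
    modulus is its fourth power times the cyclotomic polynomials of the other divisors
    \<open>d > 1\<close>.\<close>
  define f where "f = (\<lambda>d. if d = n then cyclotomic n ^ 4 else cyclotomic d)"
  let ?A = "{d. d dvd n} - {1}"
  have A: "finite ?A" "n \<in> ?A" using n False by auto
  have "ratfun_cong D R (\<Prod>d\<in>?A. f d)"
  proof (rule ratfun_cong_prod[OF A(1)])
    fix d assume d: "d \<in> ?A"
    hence "odd d" "d > 0" using assms dvd_pos_nat[OF n] by (auto dest: dvd_trans)
    define l where "l = d div 2"
    have dl: "d = 2 * l + 1" using \<open>odd d\<close> unfolding l_def by (auto elim!: oddE)
    \<comment> \<open>The locale now works modulo \<open>cyclotomic d\<close>, while
      \<open>D\<close> and \<open>R\<close> still belong to \<open>n\<close>.\<close>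
    interpret odd_modulus d l
      by standard (use d dl in auto)
    show "ratfun_cong D R (f d)"
    proof (cases "d = n")
      case True
      hence "l = m" using dl nm by simp
      have "D - R \<in> local_ideal (cyclotomic d) 4"
        using convolution_cong unfolding D_def R_def \<open>l = m\<close> True lcong_def .
      thus ?thesis using local_ideal_imp_ratfun_cong True by (simp add: f_def)
    next
      case False
      have "D \<in> local_ideal (cyclotomic d) 1"
        unfolding D_def using d by (intro convolution_ideal) auto
      moreover have "omq n / omq 1 \<in> local_ideal (cyclotomic d) 1"
        using d by (intro local_ideal_divide omq_ideal unit_omq_1) auto
      hence "(omq n / omq 1) ^ 2 \<in> local_ideal (cyclotomic d) (1 * 2)" by (rule local_ideal_power)
      hence "R \<in> local_ideal (cyclotomic d) 1"
        unfolding R_def by (intro local_ideal_mult_left reg_q_power) (auto intro: local_ideal_mono)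
      ultimately have "D - R \<in> local_ideal (cyclotomic d) 1" by (rule local_ideal_diff)
      thus ?thesis using local_ideal_imp_ratfun_cong[of D R "cyclotomic d" 1] False by (simp add: f_def)
    qed
  next
    fix c d assume "c \<in> ?A" "d \<in> ?A" "c \<noteq> d"
    hence "coprime (cyclotomic c) (cyclotomic d)"
      by (intro coprime_cyclotomic) (auto intro: dvd_pos_nat[OF n])
    thus "coprime (f c) (f d)" unfolding f_def by auto
  qed
  also have "(\<Prod>d\<in>?A. f d) = qint [:0, 1:] n * cyclotomic n ^ 3"
  proof -
    have "(\<Prod>d\<in>?A. f d) = f n * (\<Prod>d\<in>?A - {n}. f d)" by (rule prod.remove[OF A])
    also have "(\<Prod>d\<in>?A - {n}. f d) = (\<Prod>d\<in>?A - {n}. cyclotomic d)"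
      by (intro prod.cong) (auto simp: f_def)
    also have "f n * \<dots> = cyclotomic n ^ 3 * (cyclotomic n * (\<Prod>d\<in>?A - {n}. cyclotomic d))"
      by (simp add: f_def eval_nat_numeral)
    also have "cyclotomic n * (\<Prod>d\<in>?A - {n}. cyclotomic d) = qint [:0, 1:] n"
      unfolding qint_eq_prod_cyclotomic[OF n] by (rule prod.remove[OF A, symmetric])
    finally show ?thesis by (simp only: mult.commute)
  qed
  finally show ?thesis unfolding D R .
qed

end
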